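(* Let $p(z)=\sum_{i=0}^d p_iz^i$ be a polynomial of degree $d$ with $p_0\ne0$. The scaled-companion root-finding algorithm described in the context, applied to $p(z)$, is min-max elementwise backward stable under the QZ assumption stated in the context; that is, it computes roots $\widehat{\mathbf z}=[\widehat z_1,\ldots,\widehat z_d]^T$ of $p(z)$ with min-max elementwise backward error $\eta^{\mathrm{elem}}_{\widetilde{\boldsymbol\gamma}}(\widehat{\mathbf z})=\mathcal O(\epsilon_{\mathrm{mach}})$, where $\epsilon_{\mathrm{mach}}$ is the machine precision.
   Context: **Tropical roots.** Consider the upper boundary of the convex hull of the points $(j,\log|p_j|)$, $0\le j\le d$, $p_j\ne0$; its vertices are $(k_\ell,\log|p_{k_\ell}|)$, $\ell=0,\ldots,t$, with $0=k_0<k_1<\cdots<k_t=d$. Put $m_\ell=k_\ell-k_{\ell-1}$ and $\tau_\ell=(|p_{k_{\ell-1}}|/|p_{k_\ell}|)^{1/m_\ell}$ for $\ell=1,\ldots,t$, so $0<\tau_1<\cdots<\tau_t$; these are the tropical roots of $\max_{0\le i\le d}|p_i|x^i$. Let $\widetilde\tau_1\le\widetilde\tau_2\le\cdots\le\widetilde\tau_d$ be the list in which each $\tau_\ell$ is repeated $m_\ell$ times. **Scaled companion pencil.** Let $A,B$ be the $(d+1)\times(d+1)$ matrices where $A$ has first row $[p_d,p_{d-1},\ldots,p_1,p_0]$, ones on the first subdiagonal and zeros elsewhere, and $B=\mathrm{diag}(0,1,\ldots,1)$; $A-zB$ is the companion linearization of $0\cdot z^{d+1}+p(z)$. Let $$D_l=\mathrm{diag}\Bigl(\tfrac1{|p_d|},1,\prod_{j=d}^d\widetilde\tau_j,\prod_{j=d-1}^d\widetilde\tau_j,\ldots,\prod_{j=2}^d\widetilde\tau_j\Bigr),\quad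 D_r=\mathrm{diag}\Bigl(1,1/\prod_{j=d}^d\widetilde\tau_j,1/\prod_{j=d-1}^d\widetilde\tau_j,\ldots,1/\prod_{j=1}^d\widetilde\tau_j\Bigr),$$ and $\widehat A=D_lAD_r$, $\widehat B=D_lBD_r$. **Algorithm.** Form $\widehat A-z\widehat B$. Deflate the artificially introduced eigenvalue at infinity: let $\widetilde G$ be the identity matrix of order $d+1$ whose leading $2\times2$ block is replaced by a Givens rotation chosen so that the $(2,1)$ entry of $\widetilde G\widehat A$ is zero, form $\widetilde G(\widehat A-z\widehat B)$, and keep its trailing $d\times d$ pencil. Compute the eigenvalues of this deflated pencil using the QZ algorithm implemented with a strict deflation criterion for the detection of eigenvalues at infinity (entries of the second matrix are not set to zero on the basis of the usual tolerance, so that only finite eigenvalues are generated besides the trivial ones at infinity). Return these $d$ eigenvalues $\widehat z_1,\ldots,\widehat z_d$ as the roots of $p(z)$. **QZ assumption.** The QZ algorithm with a strict deflation criterion for eigenvalues at infinity applied to $\widetilde G(\widehat A-z\widehat B)$ computes the exact generalized Schur form of the matrix pencil $(\widehat A+\Delta\widehat A)-z(\widehat B+\Delta\widehat B)$, where all entries in $\Delta\widehat A$ have modulus of size $\mathcal O(\epsilon_{\mathrm{mach}})$, and the entries in column $i$ of $\Delta\widehat B$ have modulus of size $\mathcal O(\widetilde\tau_{d-i+2}^{-1}\epsilon_{\mathrm{mach}})$, except for the first column, which is equal to zero. **Min-max elementwise backward error.** For $i=0,\ldots,d$ let $$\gamma_i=\min_{|z|>0}\max_{0\le j\le d}\frac{|p_jz^j|}{|p_iz^i|}\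 \text{ if } p_i\ne0,\qquad \gamma_i=\min_{|z|>0}\max_{0\le j\le d}\frac{|p_jz^j|}{|z|^i}\ \text{ if } p_i=0,$$ and let $\widetilde\gamma_i=\gamma_i|p_i|$ if $p_i\ne0$, $\widetilde\gamma_i=\gamma_i$ if $p_i=0$ (all $\widetilde\gamma_i$ are positive). With $\widetilde p(z)=p_d\prod_{j=1}^d(z-\widehat z_j)=\sum_{i=0}^d\widetilde p_iz^i$, the min-max elementwise backward error of $\widehat{\mathbf z}$ is $$\eta^{\mathrm{elem}}_{\widetilde{\boldsymbol\gamma}}(\widehat{\mathbf z})=\min_{\mu\in\mathbb C\setminus\{0\}}\ \max_{0\le i\le d}\frac{|p_i-\mu\widetilde p_i|}{\widetilde\gamma_i}.$$ *)

theory Defs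
  imports
    "HOL-Analysis.Polytope"
    "Jordan_Normal_Form.Schur_Decomposition"
begin

text \<open>
  Matrices are those of \<open>Jordan_Normal_Form\<close>, so row and column indices start at 0:
  column \<open>c\<close> below is column \<open>c + 1\<close> in the usual numbering. The tropical roots with multiplicity
  keep their usual numbering \<open>1, \<dots>, d\<close>.
\<close>

subsection \<open>Tropical roots\<close>

definition log_points :: "complex poly \<Rightarrow> (real \<times> real) set" where
  "log_points p = {(real j, ln (cmod (coeff p j))) | j. j \<le> degree p \<and> coeff p j \<noteq> 0}"

definition upper_boundary :: "(real \<times> real) set \<Rightarrow> (real \<times> real) set" where
  "upper_boundary H = {(x, y) \<in> H. \<forall>y'. (x, y') \<in> H \<longrightarrow> y' \<le> y}"

definition vertex_indices :: "complex poly \<Rightarrow> nat list" where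
  "vertex_indices p = sorted_list_of_set
     {k. k \<le> degree p \<and> coeff p k \<noteq> 0 \<and>
         (real k, ln (cmod (coeff p k))) extreme_point_of (convex hull (log_points p)) \<and>
         (real k, ln (cmod (coeff p k))) \<in> upper_boundary (convex hull (log_points p))}"

definition trop_mult :: "complex poly \<Rightarrow> nat \<Rightarrow> nat" where
  "trop_mult p l = vertex_indices p ! l - vertex_indices p ! (l - 1)"

definition trop_root :: "complex poly \<Rightarrow> nat \<Rightarrow> real" where
  "trop_root p l = root (trop_mult p l)
     (cmod (coeff p (vertex_indices p ! (l - 1))) / cmod (coeff p (vertex_indices p ! l)))"

definition trop_root_list :: "complex poly \<Rightarrow> real list" where
  "trop_root_list p =
     concat (map (\<lambda>l. replicate (trop_mult p l) (trop_root p l)) [1..<length (vertex_indices p)])"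

definition ttau :: "complex poly \<Rightarrow> nat \<Rightarrow> real" where
  "ttau p j = trop_root_list p ! (j - 1)"

subsection \<open>The scaled companion pencil\<close>

definition companion_A :: "complex poly \<Rightarrow> complex mat" where
  "companion_A p = Matrix.mat (degree p + 1) (degree p + 1)
     (\<lambda>(r, c). if r = 0 then coeff p (degree p - c) else if r = c + 1 then 1 else 0)"

definition companion_B :: "complex poly \<Rightarrow> complex mat" where
  "companion_B p = mat_diag (degree p + 1) (\<lambda>r. if r = 0 then 0 else 1)"

text \<open>For \<open>r = 1\<close> the product in \<open>scale_left\<close> is empty.\<close>

definition scale_left :: "complex poly \<Rightarrow> complex mat" where
  "scale_left p = mat_diag (degree p + 1)
     (\<lambda>r. complex_of_real (if r = 0 then 1 / cmod (lead_coeff p)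
                           else \<Prod>j = degree p + 2 - r..degree p. ttau p j))"

definition scale_right :: "complex poly \<Rightarrow> complex mat" where
  "scale_right p = mat_diag (degree p + 1)
     (\<lambda>r. complex_of_real (1 / (\<Prod>j = degree p + 1 - r..degree p. ttau p j)))"

definition A_hat :: "complex poly \<Rightarrow> complex mat" where
  "A_hat p = scale_left p * companion_A p * scale_right p"

definition B_hat :: "complex poly \<Rightarrow> complex mat" where
  "B_hat p = scale_left p * companion_B p * scale_right p"

subsection \<open>The root-finding algorithm\<close>

text \<open>
  The complex Givens rotation with real cosine. The condition that it annihilates the (2,1) entry
  determines it up to sign.
\<close>

definition leading_givens :: "nat \<Rightarrow> complex mat \<Rightarrow> bool" where
  "leading_givens n G \<longleftrightarrow> (\<exists>(c::real) (s::complex). c\<^sup>2 + (cmod s)\<^sup>2 = 1 \<and>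
     G = Matrix.mat n n (\<lambda>(i, j).
           if i = 0 \<and> j = 0 \<or> i = 1 \<and> j = 1 then complex_of_real c
           else if i = 0 \<and> j = 1 then s
           else if i = 1 \<and> j = 0 then - cnj s
           else if i = j then 1 else 0))"

definition deflating_rotation :: "complex poly \<Rightarrow> complex mat \<Rightarrow> bool" where
  "deflating_rotation p G \<longleftrightarrow> leading_givens (degree p + 1) G \<and> (G * A_hat p) $$ (1, 0) = 0"

definition trailing :: "complex mat \<Rightarrow> complex mat" where
  "trailing M = mat_delete M 0 0"

text \<open>
  An implementation of the QZ algorithm maps a pencil, given by its two matrices, to the computed
  pair of triangular factors. It is an arbitrary function; the only thing known about it
  is \<open>qz_assumption\<close> below.
\<close>

type_synonym qz_alg = "complex mat \<Rightarrow> complex mat \<Rightarrow> complex mat \<times> complex mat"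

definition qz_deflated :: "qz_alg \<Rightarrow> complex poly \<Rightarrow> complex mat \<Rightarrow> complex mat \<times> complex mat" where
  "qz_deflated qz p G = qz (trailing (G * A_hat p)) (trailing (G * B_hat p))"

definition computes_roots :: "qz_alg \<Rightarrow> complex poly \<Rightarrow> complex list \<Rightarrow> bool" where
  "computes_roots qz p zs \<longleftrightarrow> (\<exists>G S T. deflating_rotation p G \<and> qz_deflated qz p G = (S, T) \<and>
     zs = map (\<lambda>k. S $$ (k, k) / T $$ (k, k)) [0..<degree p])"

subsection \<open>The QZ assumption\<close>

definition unitary_mat :: "nat \<Rightarrow> complex mat \<Rightarrow> bool" where
  "unitary_mat n Q \<longleftrightarrow> Q \<in> carrier_mat n n \<and> mat_adjoint Q * Q = 1\<^sub>m n"

definition generalized_schur_form ::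
  "nat \<Rightarrow> complex mat \<Rightarrow> complex mat \<Rightarrow> complex mat \<Rightarrow> complex mat \<Rightarrow> bool" where
  "generalized_schur_form n M N S T \<longleftrightarrow> (\<exists>Q Z. unitary_mat n Q \<and> unitary_mat n Z \<and>
     S = mat_adjoint Q * M * Z \<and> T = mat_adjoint Q * N * Z \<and>
     upper_triangular S \<and> upper_triangular T)"

text \<open>
  \<open>C\<close> is the constant hidden in the order symbols and \<open>\<epsilon>\<close> the machine precision.
  After the rotation, the first column of the pencil is a multiple of the first unit vector and
  does not depend on \<open>z\<close>; it carries the trivial eigenvalue at infinity, which is the position
  \<open>(0, 0)\<close> of the Schur form \<open>(S, T)\<close> of order \<open>d + 1\<close>. The factors \<open>(S', T')\<close> computed for the
  deflated pencil are the trailing blocks of \<open>(S, T)\<close>. The last conjunct is the strict deflation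
  criterion: apart from the trivial one, no eigenvalue at infinity is generated.
\<close>

definition qz_assumption :: "real \<Rightarrow> real \<Rightarrow> qz_alg \<Rightarrow> complex poly \<Rightarrow> bool" where
  "qz_assumption C \<epsilon> qz p \<longleftrightarrow> (let d = degree p in
     \<forall>G S' T'. deflating_rotation p G \<and> qz_deflated qz p G = (S', T') \<longrightarrow>
       (\<exists>\<Delta>A \<Delta>B S T.
          \<Delta>A \<in> carrier_mat (d + 1) (d + 1) \<and> \<Delta>B \<in> carrier_mat (d + 1) (d + 1) \<and>
          (\<forall>r\<le>d. \<forall>c\<le>d. cmod (\<Delta>A $$ (r, c)) \<le> C * \<epsilon>) \<and>
          (\<forall>r\<le>d. \<Delta>B $$ (r, 0) = 0) \<and>
          (\<forall>r\<le>d. \<forall>c\<in>{1..d}. cmod (\<Delta>B $$ (r, c)) \<le> C * (inverse (ttau p (d + 1 - c)) * \<epsilon>)) \<and>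
          generalized_schur_form (d + 1) (A_hat p + \<Delta>A) (B_hat p + \<Delta>B) S T \<and>
          T $$ (0, 0) = 0 \<and> S' = trailing S \<and> T' = trailing T \<and>
          (\<forall>k<d. T' $$ (k, k) \<noteq> 0)))"

subsection \<open>Min-max elementwise backward error\<close>

text \<open>
  Minima over infinite sets are written as infima of nonempty sets of nonnegative reals.
  If \<open>coeff p 0 \<noteq> 0\<close> and \<open>degree p \<ge> 1\<close>, the infimum in \<open>minmax_gamma\<close> is attained for every
  \<open>i \<le> degree p\<close>. The infimum in \<open>elem_backward_error\<close>, with the weights \<open>minmax_weight p\<close>,
  is attained whenever it is less than 1, the limit of the objective as \<open>\<mu>\<close> tends to 0.
\<close>

definition minmax_gamma :: "complex poly \<Rightarrow> nat \<Rightarrow> real" where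
  "minmax_gamma p i =
     (if coeff p i \<noteq> 0
      then INF z\<in>{z. cmod z > 0}. MAX j\<in>{0..degree p}. cmod (coeff p j * z ^ j) / cmod (coeff p i * z ^ i)
      else INF z\<in>{z. cmod z > 0}. MAX j\<in>{0..degree p}. cmod (coeff p j * z ^ j) / cmod z ^ i)"

definition minmax_weight :: "complex poly \<Rightarrow> nat \<Rightarrow> real" where
  "minmax_weight p i =
     (if coeff p i \<noteq> 0 then minmax_gamma p i * cmod (coeff p i) else minmax_gamma p i)"

definition poly_from_roots :: "complex \<Rightarrow> complex list \<Rightarrow> complex poly" where
  "poly_from_roots a zs = smult a (\<Prod>z\<leftarrow>zs. [:- z, 1:])"

definition elem_backward_error :: "(nat \<Rightarrow> real) \<Rightarrow> complex poly \<Rightarrow> complex list \<Rightarrow> real" where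
  "elem_backward_error w p zs =
     (INF \<mu>\<in>- {0}. MAX i\<in>{0..degree p}.
        cmod (coeff p i - \<mu> * coeff (poly_from_roots (lead_coeff p) zs) i) / w i)"

end

theory Submission
  imports Defs
begin

text \<open>
  Let \<open>h\<^sub>i = |p\<^sub>0| / (\<tau>\<^sub>1 \<cdots> \<tau>\<^sub>i)\<close>, with the tropical roots repeated according to multiplicity; \<open>log h\<^sub>i\<close> is
  the height at \<open>i\<close> of the upper boundary of the convex hull. Then \<open>|p\<^sub>i| \<le> h\<^sub>i\<close>, so the scaled matrix
  \<open>A\<close> has entries of modulus at most 1, while column \<open>c\<close> of the scaled \<open>B\<close> (counted from 0) has entries
  of modulus at most \<open>1/\<tau>\<close> for the root \<open>\<tau>\<close> of index \<open>d + 1 - c\<close>, and column 0 vanishes. The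
  assumption on QZ perturbs every column by a relative amount \<open>O(\<epsilon>)\<close> of these bounds, so expanding
  the determinant over permutations perturbs the coefficient of \<open>z\<^sup>i\<close> by \<open>O(\<epsilon>)\<close> times a product of
  \<open>i\<close> reciprocal tropical roots, which is largest for the \<open>i\<close> smallest roots. As
  \<open>p = \<plusminus>|p\<^sub>0| det (A - zB)\<close>, the perturbation of \<open>p\<^sub>i\<close> is \<open>O(\<epsilon>) h\<^sub>i\<close>; and \<open>h\<^sub>i\<close> is at most the min-max
  weight, because \<open>h\<^sub>i |z|\<^sup>i\<close> is a weighted geometric mean of the terms \<open>|p\<^sub>k z\<^sup>k|\<close> at the two end points
  of the hull edge above \<open>i\<close>. The Schur form shows that the perturbed determinant is a nonzero multiple
  of the polynomial with the computed roots.
\<close>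

subsection \<open>Coefficientwise majorants\<close>

text \<open>A real polynomial used as a bound respects sums and products, so bounds on the entries
  of a pencil multiply to bounds on every coefficient of its determinant.\<close>

definition majorized :: "'a::real_normed_field poly \<Rightarrow> real poly \<Rightarrow> bool" (infix "\<preceq>m" 50) where
  "f \<preceq>m F \<longleftrightarrow> (\<forall>k. norm (coeff f k) \<le> coeff F k)"

lemma majorizedD: "f \<preceq>m F \<Longrightarrow> norm (coeff f k) \<le> coeff F k"
  by (simp add: majorized_def)

lemma majorized_nonneg: "f \<preceq>m F \<Longrightarrow> 0 \<le> coeff F k"
  using norm_ge_zero order_trans unfolding majorized_def by blast

text \<open>The polynomial \<open>g\<close> serves only as a witness that the coefficients of
  \<open>F\<close> are nonnegative.\<close>

lemma majorized_mono:
  assumes "f \<preceq>m smult a F" "g \<preceq>m F" "a \<le> b"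
  shows "f \<preceq>m smult b F"
proof -
  have "a * coeff F k \<le> b * coeff F k" for k
    using assms(3) majorized_nonneg[OF assms(2)] by (intro mult_right_mono) auto
  then show ?thesis
    using assms(1) order_trans unfolding majorized_def by (metis coeff_smult)
qed

lemma majorized_add:
  assumes "f \<preceq>m F" "g \<preceq>m G"
  shows "f + g \<preceq>m F + G"
  using assms unfolding majorized_def by (auto intro!: order_trans[OF norm_triangle_ineq] add_mono)

lemma majorized_sum:
  assumes "\<And>i. i \<in> I \<Longrightarrow> f i \<preceq>m F i"
  shows "sum f I \<preceq>m sum F I"
  using assms unfolding majorized_def by (auto simp: coeff_sum intro!: sum_norm_le)

lemma majorized_mult:
  assumes "f \<preceq>m F" "g \<preceq>m G"
  shows "f * g \<preceq>m F * G"
  unfolding majorized_def coeff_mult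
  using assms majorized_nonneg[OF assms(1)] 
  by (auto simp: norm_mult majorized_def intro!: sum_norm_le mult_mono)

text \<open>One induction carries all three bounds. Since \<open>\<delta> \<le> 1\<close>, each
  \<open>g i\<close> is bounded by twice \<open>F i\<close>, which controls the mixed products that
  arise when the factors are exchanged one at a time.\<close>

lemma majorized_prod_perturb:
  fixes f g :: "'i \<Rightarrow> 'a::real_normed_field poly"
  assumes "finite I" "0 \<le> \<delta>" "\<delta> \<le> 1"
    and "\<And>i. i \<in> I \<Longrightarrow> f i \<preceq>m F i"
    and "\<And>i. i \<in> I \<Longrightarrow> g i - f i \<preceq>m smult \<delta> (F i)"
  shows "prod f I \<preceq>m prod F I \<and> prod g I \<preceq>m smult (2 ^ card I) (prod F I) \<and>
    prod g I - prod f I \<preceq>m smult ((2 ^ card I - 1) * \<delta>) (prod F I)"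
  using assms(1,4,5)
proof (induction I rule: finite_induct)
  case empty
  have "(1::'a poly) \<preceq>m 1"
    by (simp add: majorized_def coeff_1)
  moreover have "(0::'a poly) \<preceq>m 0"
    by (simp add: majorized_def)
  ultimately show ?case by (simp add: one_pCons)
next
  case (insert x I)
  have f: "f x \<preceq>m F x" and gf: "g x - f x \<preceq>m smult \<delta> (F x)"
    using insert.prems by auto
  have IH: "prod f I \<preceq>m prod F I" "prod g I \<preceq>m smult (2 ^ card I) (prod F I)"
    "prod g I - prod f I \<preceq>m smult ((2 ^ card I - 1) * \<delta>) (prod F I)"
    using insert by auto
  have "g x - f x + f x \<preceq>m smult \<delta> (F x) + F x"
    by (rule majorized_add[OF gf f])
  then have "g x \<preceq>m smult (\<delta> + 1) (F x)"
    by (simp add: smult_add_left)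
  then have g: "g x \<preceq>m smult 2 (F x)"
    by (rule majorized_mono[OF _ f]) (use assms(3) in simp)
  \<comment> \<open>The difference of products is split as in the product rule; the constants
    combine as \<open>2 ^ n + (2 ^ n - 1) = 2 ^ (n + 1) - 1\<close>.\<close>
  have "(g x - f x) * prod g I + f x * (prod g I - prod f I) \<preceq>m
     smult \<delta> (F x) * smult (2 ^ card I) (prod F I) + F x * smult ((2 ^ card I - 1) * \<delta>) (prod F I)"
    by (intro majorized_add majorized_mult gf f IH)
  also have "(g x - f x) * prod g I + f x * (prod g I - prod f I) = prod g (insert x I) - prod f (insert x I)"
    using insert.hyps by (simp add: algebra_simps)
  also have "smult \<delta> (F x) * smult (2 ^ card I) (prod F I) + F x * smult ((2 ^ card I - 1) * \<delta>) (prod F I)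
     = smult ((2 ^ card (insert x I) - 1) * \<delta>) (prod F (insert x I))"
    using insert.hyps by (simp add: algebra_simps flip: smult_add_left)
  finally have "prod g (insert x I) - prod f (insert x I)
      \<preceq>m smult ((2 ^ card (insert x I) - 1) * \<delta>) (prod F (insert x I))" .
  moreover have "prod f (insert x I) \<preceq>m prod F (insert x I)"
    using majorized_mult[OF f IH(1)] insert.hyps by simp
  moreover have "prod g (insert x I) \<preceq>m smult (2 ^ card (insert x I)) (prod F (insert x I))"
    using majorized_mult[OF g IH(2)] insert.hyps by (simp add: mult.commute)
  ultimately show ?case by blast
qed

text \<open>The bound \<open>F c\<close> depends on the column only, so all \<open>fact n\<close>
  terms of the Leibniz expansion share the majorant \<open>\<Prod>c<n. F c\<close>.\<close>

lemma det_perturb_majorized: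
  fixes M N :: "'a::real_normed_field poly mat"
  assumes M: "M \<in> carrier_mat n n" and N: "N \<in> carrier_mat n n"
    and \<delta>: "0 \<le> \<delta>" "\<delta> \<le> 1"
    and maj: "\<And>r c. r < n \<Longrightarrow> c < n \<Longrightarrow> M $$ (r, c) \<preceq>m F c"
    and diff: "\<And>r c. r < n \<Longrightarrow> c < n \<Longrightarrow> N $$ (r, c) - M $$ (r, c) \<preceq>m smult \<delta> (F c)"
  shows "det N - det M \<preceq>m smult (fact n * 2 ^ n * \<delta>) (\<Prod>c<n. F c)"
proof -
  let ?P = "{\<pi>. \<pi> permutes {0..<n}}"
  have summand: "signof \<pi> * (\<Prod>j<n. N $$ (\<pi> j, j)) - signof \<pi> * (\<Prod>j<n. M $$ (\<pi> j, j))
      \<preceq>m smult (2 ^ n * \<delta>) (\<Prod>c<n. F c)" if "\<pi> \<in> ?P" for \<pi>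
  proof -
    have lt: "\<pi> j < n" if "j < n" for j
      using permutes_in_image[of \<pi> "{0..<n}" j] \<open>\<pi> \<in> ?P\<close> that by auto
    have maj': "(\<Prod>j<n. M $$ (\<pi> j, j)) \<preceq>m (\<Prod>c<n. F c)"
      and diff': "(\<Prod>j<n. N $$ (\<pi> j, j)) - (\<Prod>j<n. M $$ (\<pi> j, j)) \<preceq>m
          smult ((2 ^ n - 1) * \<delta>) (\<Prod>c<n. F c)"
      using majorized_prod_perturb[of "{..<n}" \<delta> "\<lambda>j. M $$ (\<pi> j, j)" F "\<lambda>j. N $$ (\<pi> j, j)"]
        \<delta> maj diff lt by auto
    \<comment> \<open>The constant \<open>2 ^ n - 1\<close> is rounded up; the sign of the
      permutation does not affect the norm.\<close>
    have "(\<Prod>j<n. N $$ (\<pi> j, j)) - (\<Prod>j<n. M $$ (\<pi> j, j)) \<preceq>m smult (2 ^ n * \<delta>) (\<Prod>c<n. F c)"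
      by (rule majorized_mono[OF diff' maj']) (use \<delta> in \<open>simp add: algebra_simps\<close>)
    then show ?thesis
      by (cases "sign \<pi> = 1") (auto simp: sign_def majorized_def norm_minus_commute)
  qed
  have "det N - det M = (\<Sum>\<pi>\<in>?P. signof \<pi> * (\<Prod>j<n. N $$ (\<pi> j, j)) - signof \<pi> * (\<Prod>j<n. M $$ (\<pi> j, j)))"
    by (simp add: det_col[OF M] det_col[OF N] sum_subtractf)
  also have "\<dots> \<preceq>m (\<Sum>\<pi>\<in>?P. smult (2 ^ n * \<delta>) (\<Prod>c<n. F c))"
    by (intro majorized_sum summand)
  also have "(\<Sum>\<pi>\<in>?P. smult (2 ^ n * \<delta>) (\<Prod>c<n. F c)) = smult (fact n * 2 ^ n * \<delta>) (\<Prod>c<n. F c)"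
    by (simp add: card_permutations[of _ n] mult.assoc poly_eq_iff of_nat_poly)
  finally show ?thesis .
qed

text \<open>The coefficient is an elementary symmetric function with at most \<open>2 ^ m\<close>
  terms, and for decreasing positive \<open>u\<close> the largest term is the product of the first
  \<open>i\<close> values.\<close>

lemma coeff_prod_linear_le:
  fixes u :: "nat \<Rightarrow> real"
  assumes "\<And>j. j \<in> {1..m} \<Longrightarrow> 0 < u j"
    and "\<And>i j. 1 \<le> i \<Longrightarrow> i \<le> j \<Longrightarrow> j \<le> m \<Longrightarrow> u j \<le> u i"
  shows "coeff (\<Prod>j=1..m. [:1, u j:]) i \<le> (if i \<le> m then 2 ^ m * (\<Prod>j=1..i. u j) else 0)"
  using assms
proof (induction m arbitrary: i)
  case 0
  then show ?case by (auto simp: coeff_1)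
next
  case (Suc m)
  have IH: "coeff (\<Prod>j=1..m. [:1, u j:]) i \<le> (if i \<le> m then 2 ^ m * (\<Prod>j=1..i. u j) else 0)" for i
    by (rule Suc.IH) (use Suc.prems in auto)
  have step: "(\<Prod>j=1..Suc m. [:1, u j:]) = [:1, u (Suc m):] * (\<Prod>j=1..m. [:1, u j:])"
    by (simp add: mult.commute)
  show ?case
  proof (cases i)
    case 0
    then show ?thesis
      using IH[of 0] order_trans[of _ "2 ^ m" "2 * 2 ^ m :: real"] unfolding step by simp
  next
    case (Suc i')
    have pos: "0 < (\<Prod>j=1..k. u j)" if "k \<le> Suc m" for k
      using Suc.prems(1) that by (intro prod_pos) auto
    have "coeff (\<Prod>j=1..Suc m. [:1, u j:]) i =
        coeff (\<Prod>j=1..m. [:1, u j:]) i + u (Suc m) * coeff (\<Prod>j=1..m. [:1, u j:]) i'"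
      unfolding step by (simp add: Suc)
    also have "\<dots> \<le> (if i \<le> m then 2 ^ m * (\<Prod>j=1..i. u j) else 0) +
        u (Suc m) * (if i' \<le> m then 2 ^ m * (\<Prod>j=1..i'. u j) else 0)"
      using Suc.prems(1)[of "Suc m"] by (intro add_mono IH mult_left_mono) auto
    also have "\<dots> \<le> (if i \<le> Suc m then 2 ^ Suc m * (\<Prod>j=1..i. u j) else 0)"
    proof (cases "i \<le> Suc m")
      case True
      \<comment> \<open>The new factor \<open>u (Suc m)\<close> is the smallest, so it may be
        replaced by \<open>u i\<close>, which completes the product up to \<open>i\<close>.\<close>
      have "u (Suc m) * (2 ^ m * (\<Prod>j=1..i'. u j)) \<le> u i * (2 ^ m * (\<Prod>j=1..i'. u j))"
        using Suc.prems(2)[of i "Suc m"] Suc True pos[of i'] by (intro mult_right_mono) auto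
      also have "\<dots> = 2 ^ m * (\<Prod>j=1..i. u j)"
        by (simp add: Suc mult_ac)
      finally show ?thesis
        using True Suc pos[of i] by (auto simp: mult_ac)
    qed (use Suc in auto)
    finally show ?thesis .
  qed
qed

subsection \<open>Matrix pencils and their determinants\<close>

lemma det_upper_triangular_prod:
  assumes "upper_triangular M" "M \<in> carrier_mat n n"
  shows "det M = (\<Prod>i<n. M $$ (i, i))"
  using assms by (auto simp: det_upper_triangular prod_list_diag_prod lessThan_atLeast0)

text \<open>The pencil \<open>M - z N\<close> with \<open>z\<close> as the polynomial variable, so
  that its determinant has coefficients to compare.\<close>

definition lin_pencil :: "nat \<Rightarrow> complex mat \<Rightarrow> complex mat \<Rightarrow> complex poly mat" where
  "lin_pencil n M N = Matrix.mat n n (\<lambda>(i, j). [:M $$ (i, j), - N $$ (i, j):])"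

lemma lin_pencil_carrier [simp]: "lin_pencil n M N \<in> carrier_mat n n"
  by (simp add: lin_pencil_def)

lemma poly_det_lin_pencil:
  assumes "M \<in> carrier_mat n n" "N \<in> carrier_mat n n"
  shows "poly (det (lin_pencil n M N)) z = det (M - z \<cdot>\<^sub>m N)"
proof -
  have c: "M - z \<cdot>\<^sub>m N \<in> carrier_mat n n"
    using assms by auto
  have sg: "poly (signof \<pi>) z = signof \<pi>" for \<pi> :: "nat \<Rightarrow> nat"
    by (simp add: sign_def)
  have "M $$ (\<pi> j, j) - z * N $$ (\<pi> j, j) = (M - z \<cdot>\<^sub>m N) $$ (\<pi> j, j)"
    if "\<pi> permutes {0..<n}" "j < n" for \<pi> j
    using assms that permutes_in_image[of \<pi> "{0..<n}" j] by auto
  moreover have "poly (lin_pencil n M N $$ (\<pi> j, j)) z = M $$ (\<pi> j, j) - z * N $$ (\<pi> j, j)"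
    if "\<pi> permutes {0..<n}" "j < n" for \<pi> j
    using that permutes_in_image[of \<pi> "{0..<n}" j] by (auto simp: lin_pencil_def)
  ultimately show ?thesis
    unfolding det_col[OF lin_pencil_carrier] det_col[OF c]
    by (simp add: poly_sum poly_prod sg)
qed

lemma det_unitary_nonzero:
  assumes "unitary_mat n Q"
  shows "det Q \<noteq> 0" "det (mat_adjoint Q) \<noteq> 0"
proof -
  have Q: "Q \<in> carrier_mat n n" "mat_adjoint Q \<in> carrier_mat n n"
    using assms by (auto simp: unitary_mat_def mat_adjoint_def)
  have "det (mat_adjoint Q) * det Q = 1"
    using assms det_mult[OF Q(2,1)] by (simp add: unitary_mat_def)
  then show "det Q \<noteq> 0" "det (mat_adjoint Q) \<noteq> 0" by auto
qed

text \<open>Unitary factors change the determinant only by a nonzero constant, and the determinant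
  of a triangular pencil is the product of its diagonal.\<close>

lemma generalized_schur_form_det:
  assumes M: "M \<in> carrier_mat n n" and N: "N \<in> carrier_mat n n"
    and schur: "generalized_schur_form n M N S T"
  obtains \<kappa> where "\<kappa> \<noteq> 0" "det (lin_pencil n M N) = smult \<kappa> (\<Prod>k<n. [:S $$ (k, k), - T $$ (k, k):])"
    "S \<in> carrier_mat n n" "T \<in> carrier_mat n n"
proof -
  obtain Q Z where Q: "unitary_mat n Q" and Z: "unitary_mat n Z"
    and S: "S = mat_adjoint Q * M * Z" and T: "T = mat_adjoint Q * N * Z"
    and ut: "upper_triangular S" "upper_triangular T"
    using schur unfolding generalized_schur_form_def by blast
  have Qc: "mat_adjoint Q \<in> carrier_mat n n" and Zc: "Z \<in> carrier_mat n n"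
    using Q Z by (auto simp: unitary_mat_def mat_adjoint_def)
  have Sc: "S \<in> carrier_mat n n" and Tc: "T \<in> carrier_mat n n"
    using Qc Zc M N by (auto simp: S T)
  let ?\<alpha> = "det (mat_adjoint Q) * det Z"
  have \<alpha>: "?\<alpha> \<noteq> 0"
    using det_unitary_nonzero Q Z by auto
  \<comment> \<open>The identity is checked at every \<open>z\<close>, where the matrices have
    scalar entries; the constant is the inverse of the two determinants.\<close>
  have "poly (det (lin_pencil n M N)) z = poly (smult (inverse ?\<alpha>) (\<Prod>k<n. [:S $$ (k, k), - T $$ (k, k):])) z" for z
  proof -
    have MN: "M - z \<cdot>\<^sub>m N \<in> carrier_mat n n" 
      using M N by auto
    have "S - z \<cdot>\<^sub>m T = mat_adjoint Q * (M - z \<cdot>\<^sub>m N) * Z"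
      using Qc Zc M N unfolding S T
      by (simp add: mult_minus_distrib_mat[of _ n n] minus_mult_distrib_mat[of _ n n]
          mult_smult_distrib[of _ n n _ n] mult_smult_assoc_mat[of _ n n _ n])
    then have "det (S - z \<cdot>\<^sub>m T) = ?\<alpha> * det (M - z \<cdot>\<^sub>m N)"
      using Qc Zc MN by (simp add: det_mult[of _ n])
    moreover have "det (S - z \<cdot>\<^sub>m T) = (\<Prod>k<n. S $$ (k, k) - z * T $$ (k, k))"
    proof -
      have "upper_triangular (S - z \<cdot>\<^sub>m T)"
        using ut Sc Tc by (auto simp: upper_triangular_def)
      moreover have "S - z \<cdot>\<^sub>m T \<in> carrier_mat n n"
        using Sc Tc by auto
      ultimately show ?thesis
        using Sc Tc by (simp add: det_upper_triangular_prod)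
    qed
    ultimately have "det (M - z \<cdot>\<^sub>m N) = inverse ?\<alpha> * (\<Prod>k<n. S $$ (k, k) - z * T $$ (k, k))"
      using \<alpha> by (simp add: field_simps)
    then show ?thesis
      by (simp add: poly_det_lin_pencil[OF M N] poly_prod)
  qed
  then have "det (lin_pencil n M N) = smult (inverse ?\<alpha>) (\<Prod>k<n. [:S $$ (k, k), - T $$ (k, k):])"
    using poly_eq_poly_eq_iff by blast
  with \<alpha> Sc Tc that[of "inverse ?\<alpha>"] show thesis by simp
qed

subsection \<open>The upper hull and the tropical roots\<close>

definition log_coeff :: "complex poly \<Rightarrow> nat \<Rightarrow> real" where
  "log_coeff p j = ln (cmod (coeff p j))"

abbreviation support :: "complex poly \<Rightarrow> nat set" where
  "support p \<equiv> {j. j \<le> degree p \<and> coeff p j \<noteq> 0}"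

lemma log_points_image: "log_points p = (\<lambda>j. (real j, log_coeff p j)) ` support p"
  by (auto simp: log_points_def log_coeff_def)

definition hull_vertices :: "complex poly \<Rightarrow> nat set" where
  "hull_vertices p = set (vertex_indices p)"

lemma finite_hull_vertices: "finite (hull_vertices p)"
  by (simp add: hull_vertices_def)

lemma hull_vertices_iff:
  "k \<in> hull_vertices p \<longleftrightarrow> k \<in> support p \<and>
     (real k, log_coeff p k) extreme_point_of (convex hull (log_points p)) \<and>
     (real k, log_coeff p k) \<in> upper_boundary (convex hull (log_points p))"
  unfolding hull_vertices_def vertex_indices_def log_coeff_def
  by (subst set_sorted_list_of_set) auto

section \<open>Supporting lines and vertices of the hull\<close>

lemma hull_below_line:
  fixes s :: real
  assumes "\<And>j. j \<in> support p \<Longrightarrow> log_coeff p j - s * j \<le> m"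
    and "(x, y) \<in> convex hull (log_points p)"
  shows "y - s * x \<le> m"
proof -
  have "convex {(x, y). y - s * x \<le> m}"
  proof -
    have "{(x, y). y - s * x \<le> m} = {v. inner (- s, 1) v \<le> m}"
      by auto
    then show ?thesis
      by (simp add: convex_halfspace_le)
  qed
  then have "convex hull (log_points p) \<subseteq> {(x, y). y - s * x \<le> m}"
    using assms(1) by (intro hull_minimal) (auto simp: log_points_image)
  then show ?thesis
    using assms(2) by auto
qed

text \<open>The point is the unique maximum in a lexicographic order: first by height relative to
  slope \<open>s\<close>, then by position to the left. Hence it is not in the hull of the other
  points, and the supporting line puts it on the upper boundary.\<close>

lemma leftmost_maximizer_hull_vertex:
  fixes s :: real
  assumes k: "k \<in> support p"
    and max: "\<And>j. j \<in> support p \<Longrightarrow> log_coeff p j - s * j \<le> log_coeff p k - s * k"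
    and left: "\<And>j. j \<in> support p \<Longrightarrow> log_coeff p j - s * j = log_coeff p k - s * k \<Longrightarrow> k \<le> j"
  shows "k \<in> hull_vertices p"
proof -
  define m where "m = log_coeff p k - s * k"
  let ?v = "(real k, log_coeff p k)"
  have v: "?v \<in> log_points p"
    using k by (auto simp: log_points_image)
  \<comment> \<open>The lexicographically smaller points form a convex set, neither open nor closed,
    that contains all other points.\<close>
  let ?L = "{(x::real, y::real). y - s * x < m \<or> (y - s * x = m \<and> real k < x)}"
  have "convex ?L"
  proof (rule convexI)
    fix v w :: "real \<times> real" and a b :: real
    assume v: "v \<in> ?L" and w: "w \<in> ?L" and ab: "0 \<le> a" "0 \<le> b" "a + b = 1"
    obtain x y where v_eq: "v = (x, y)" by (cases v)
    obtain x' y' where w_eq: "w = (x', y')" by (cases w)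
    let ?f = "y - s * x" and ?f' = "y' - s * x'"
    have eq: "(a * y + b * y') - s * (a * x + b * x') = a * ?f + b * ?f'"
      by (simp add: algebra_simps)
    \<comment> \<open>Strict inequalities survive scaling only by positive weights, so the trivial
      combinations are set apart.\<close>
    consider "a = 0" | "b = 0" | "0 < a" "0 < b"
      using ab by linarith
    then have "a * ?f + b * ?f' < m \<or> (a * ?f + b * ?f' = m \<and> real k < a * x + b * x')"
    proof cases
      case 3
      have le: "a * ?f \<le> a * m" "b * ?f' \<le> b * m"
        using v w ab by (auto simp: v_eq w_eq intro!: mult_left_mono)
      have m: "a * m + b * m = m"
        using ab by (metis distrib_right mult_1)
      show ?thesis
      proof (cases "?f < m \<or> ?f' < m")
        case True
        then have "a * ?f < a * m \<or> b * ?f' < b * m"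
          using 3 by (auto intro: mult_strict_left_mono)
        then show ?thesis
          using le m by linarith
      next
        case False
        then have "?f = m" "?f' = m" "k < x" "k < x'"
          using v w by (auto simp: v_eq w_eq)
        moreover have "a * k + b * k < a * x + b * x'"
          using 3 \<open>k < x\<close> \<open>k < x'\<close> by (intro add_strict_mono mult_strict_left_mono)
        moreover have "a * k + b * k = k"
          using ab by (metis distrib_right mult_1)
        ultimately show ?thesis
          using m by auto
      qed
    qed (use ab v w in \<open>auto simp: v_eq w_eq\<close>)
    then show "a *\<^sub>R v + b *\<^sub>R w \<in> ?L"
      by (simp add: v_eq w_eq eq)
  qed
  moreover have "log_points p - {?v} \<subseteq> ?L"
  proof -
    have "log_coeff p j - s * j < m \<or> log_coeff p j - s * j = m \<and> k < j"
      if "j \<in> support p" "j \<noteq> k" for j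
      using max[OF that(1)] left[OF that(1)] that(2) unfolding m_def by force
    then show ?thesis
      unfolding log_points_image by force
  qed
  ultimately have "convex hull (log_points p - {?v}) \<subseteq> ?L"
    by (intro hull_minimal)
  moreover have "?v \<notin> ?L"
    by (simp add: m_def)
  moreover have "finite (log_points p - {?v})"
    by (simp add: log_points_image)
  ultimately have "?v extreme_point_of (convex hull (insert ?v (log_points p - {?v})))"
    by (intro extreme_point_of_convex_hull_insert) auto
  moreover have "insert ?v (log_points p - {?v}) = log_points p"
    using v by auto
  moreover have "?v \<in> upper_boundary (convex hull (log_points p))"
  proof -
    have "y \<le> log_coeff p k" if "(real k, y) \<in> convex hull (log_points p)" for y
      using hull_below_line[OF max that] by simp
    then show ?thesis
      using v by (simp add: upper_boundary_def hull_inc)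
  qed
  ultimately show ?thesis
    using k by (simp add: hull_vertices_iff)
qed

text \<open>The support is finite, so a maximum is attained and its leftmost maximizer is a
  vertex.\<close>

lemma support_has_hull_vertex:
  fixes s :: real
  assumes "p \<noteq> 0"
  obtains k where "k \<in> hull_vertices p"
    "\<And>j. j \<in> support p \<Longrightarrow> log_coeff p j - s * j \<le> log_coeff p k - s * k"
proof -
  define m where "m = Max ((\<lambda>j. log_coeff p j - s * j) ` support p)"
  define J where "J = {j \<in> support p. log_coeff p j - s * j = m}"
  have ne: "support p \<noteq> {}"
    using assms by (auto intro: exI[of _ "degree p"])
  then have "m \<in> (\<lambda>j. log_coeff p j - s * j) ` support p"
    unfolding m_def by (intro Max_in) auto
  then have "J \<noteq> {}" "finite J"
    by (auto simp: J_def)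
  then have J: "Min J \<in> J" "\<And>j. j \<in> J \<Longrightarrow> Min J \<le> j"
    by auto
  have le: "log_coeff p j - s * j \<le> m" if "j \<in> support p" for j
    unfolding m_def using that by (intro Max_ge) auto
  have "Min J \<in> hull_vertices p"
    by (rule leftmost_maximizer_hull_vertex[where s = s]) (use J le in \<open>auto simp: J_def\<close>)
  then show thesis
    using that[of "Min J"] J(1) le by (auto simp: J_def)
qed

text \<open>Steep lines single out the end points of the hull.\<close>

lemma end_hull_vertices:
  assumes "coeff p 0 \<noteq> 0"
  shows "0 \<in> hull_vertices p" "degree p \<in> hull_vertices p"
proof -
  have p: "p \<noteq> 0"
    using assms by auto
  define m where "m = Max ((\<lambda>j. \<bar>log_coeff p j\<bar>) ` support p)"
  have bound: "\<bar>log_coeff p j\<bar> \<le> m" if "j \<in> support p" for j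
    unfolding m_def using that by (intro Max_ge) auto
  have supp: "0 \<in> support p" "degree p \<in> support p"
    using assms p by auto
  have m: "0 \<le> m"
    using bound[OF supp(1)] by linarith
  obtain k where k: "k \<in> hull_vertices p"
    and max: "\<And>j. j \<in> support p \<Longrightarrow> log_coeff p j - (2 * m + 1) * j \<le> log_coeff p k - (2 * m + 1) * k"
    using support_has_hull_vertex[OF p] by blast
  have "k \<in> support p"
    using k by (simp add: hull_vertices_iff)
  \<comment> \<open>Heights differ by at most \<open>2 * m\<close>, whereas one step to the right
    costs \<open>2 * m + 1\<close>; so the maximizer cannot leave 0.\<close>
  have "(2 * m + 1) * k \<le> 2 * m"
    using max[OF supp(1)] bound[OF supp(1)] bound[OF \<open>k \<in> support p\<close>] by (simp add: abs_le_iff)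
  moreover have "(2 * m + 1) * 1 \<le> (2 * m + 1) * k" if "k \<noteq> 0"
    using that m by (intro mult_left_mono) auto
  ultimately show "0 \<in> hull_vertices p"
    using k by (cases "k = 0") auto
  obtain k' where k': "k' \<in> hull_vertices p"
    and max': "\<And>j. j \<in> support p \<Longrightarrow> log_coeff p j - (- (2 * m + 1)) * j \<le> log_coeff p k' - (- (2 * m + 1)) * k'"
    using support_has_hull_vertex[OF p] by blast
  have supp': "k' \<in> support p"
    using k' by (simp add: hull_vertices_iff)
  have "(2 * m + 1) * (real (degree p) - k') \<le> 2 * m"
    using max'[OF supp(2)] bound[OF supp(2)] bound[OF supp'] by (simp add: abs_le_iff algebra_simps)
  moreover have "(2 * m + 1) * 1 \<le> (2 * m + 1) * (real (degree p) - k')" if "k' \<noteq> degree p"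
    using that m supp' by (intro mult_left_mono) auto
  ultimately show "degree p \<in> hull_vertices p"
    using k' by (cases "k' = degree p") auto
qed

text \<open>The chord lies in the hull and the vertex on its upper boundary. Denominators are
  cleared for later linear arithmetic.\<close>

lemma hull_vertex_above_chord:
  assumes a: "a \<in> support p" and c: "c \<in> support p" and b: "b \<in> hull_vertices p"
    and "a < b" "b < c"
  shows "(real c - a) * log_coeff p b \<ge> (real c - b) * log_coeff p a + (real b - a) * log_coeff p c"
proof -
  define t where "t = (real b - a) / (real c - a)"
  have ca: "real c - a > 0"
    using assms by simp
  have t: "0 \<le> t" "t \<le> 1"
    using assms by (auto simp: t_def field_simps)
  have tc: "t * (real c - a) = real b - a"
    using ca by (simp add: t_def)
  have "(1 - t) *\<^sub>R (real a, log_coeff p a) + t *\<^sub>R (real c, log_coeff p c) \<in> convex hull (log_points p)"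
    using a c t by (intro convexD_alt[OF convex_convex_hull]) (auto simp: log_points_image intro: hull_inc)
  moreover have "(1 - t) * a + t * c = real b"
    using tc by (simp add: algebra_simps)
  ultimately have "(real b, (1 - t) * log_coeff p a + t * log_coeff p c) \<in> convex hull (log_points p)"
    by simp
  then have "(1 - t) * log_coeff p a + t * log_coeff p c \<le> log_coeff p b"
    using b by (auto simp: hull_vertices_iff upper_boundary_def)
  then have "(real c - a) * ((1 - t) * log_coeff p a + t * log_coeff p c) \<le> (real c - a) * log_coeff p b"
    using ca by (intro mult_left_mono) auto
  moreover have "(real c - a) * ((1 - t) * log_coeff p a + t * log_coeff p c) =
      ((real c - a) - t * (real c - a)) * log_coeff p a + (t * (real c - a)) * log_coeff p c"
    by (simp add: algebra_simps)
  ultimately show ?thesis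
    by (simp add: tc)
qed

text \<open>A point above the edge line would give a vertex \<open>k\<close> maximal in the
  direction of the edge and strictly above that line. It cannot lie between \<open>a\<close> and
  \<open>b\<close>, and outside it would push a chord above \<open>a\<close> or
  \<open>b\<close>.\<close>

lemma support_below_edge:
  assumes a: "a \<in> hull_vertices p" and b: "b \<in> hull_vertices p" and "a < b"
    and consec: "hull_vertices p \<inter> {a<..<b} = {}"
    and j: "j \<in> support p"
  shows "log_coeff p j \<le> log_coeff p a + (log_coeff p b - log_coeff p a) / (real b - a) * (real j - a)"
proof (rule ccontr)
  assume above: "\<not> ?thesis"
  define s where "s = (log_coeff p b - log_coeff p a) / (real b - a)"
  have sb: "log_coeff p b - s * b = log_coeff p a - s * a"
  proof -
    have "s * (real b - a) = log_coeff p b - log_coeff p a"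
      using \<open>a < b\<close> by (simp add: s_def)
    then show ?thesis
      by (simp add: algebra_simps)
  qed
  have supp: "a \<in> support p" "b \<in> support p"
    using a b by (simp_all add: hull_vertices_iff)
  then have "p \<noteq> 0" by auto
  then obtain k where k: "k \<in> hull_vertices p"
    and max: "\<And>i. i \<in> support p \<Longrightarrow> log_coeff p i - s * i \<le> log_coeff p k - s * k"
    using support_has_hull_vertex by blast
  have ks: "k \<in> support p"
    using k by (simp add: hull_vertices_iff)
  have gt: "log_coeff p a - s * a < log_coeff p k - s * k"
  proof -
    have "log_coeff p a + s * (real j - a) < log_coeff p j"
      using above by (simp only: s_def not_le)
    then show ?thesis
      using max[OF j] by (simp add: algebra_simps)
  qed
  then have "k \<noteq> a" "k \<noteq> b"
    using sb by auto
  then consider "k < a" | "b < k"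
    using k consec by fastforce
  then show False
  proof cases
    case 1
    \<comment> \<open>Since \<open>k\<close> is above the edge line, the chord from \<open>k\<close>
      to \<open>b\<close> passes above the vertex \<open>a\<close>; the other case is its mirror
      image.\<close>
    have "(real b - k) * log_coeff p a \<ge> (real b - a) * log_coeff p k + (real a - k) * log_coeff p b"
      by (rule hull_vertex_above_chord) (use ks supp a 1 \<open>a < b\<close> in auto)
    moreover have "log_coeff p b = log_coeff p a - s * a + s * b"
      using sb by simp
    ultimately have "(real b - a) * (log_coeff p k - s * k) \<le> (real b - a) * (log_coeff p a - s * a)"
      by (simp add: algebra_simps)
    then show False
      using gt \<open>a < b\<close> by (simp add: mult_le_cancel_left)
  next
    case 2
    have "(real k - a) * log_coeff p b \<ge> (real k - b) * log_coeff p a + (real b - a) * log_coeff p k"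
      by (rule hull_vertex_above_chord) (use ks supp b 2 \<open>a < b\<close> in auto)
    moreover have "log_coeff p b = log_coeff p a - s * a + s * b"
      using sb by simp
    ultimately have "(real b - a) * (log_coeff p k - s * k) \<le> (real b - a) * (log_coeff p a - s * a)"
      by (simp add: algebra_simps)
    then show False
      using gt \<open>a < b\<close> by (simp add: mult_le_cancel_left)
  qed
qed


section \<open>Edges of the upper hull and the tropical roots they carry\<close>

definition hull_edge :: "complex poly \<Rightarrow> nat \<Rightarrow> nat \<Rightarrow> bool" where
  "hull_edge p a b \<longleftrightarrow> a \<in> hull_vertices p \<and> b \<in> hull_vertices p \<and> a < b \<and>
     hull_vertices p \<inter> {a<..<b} = {}"

text \<open>The negative logarithm of the tropical root that belongs to the edge.\<close>

definition edge_slope :: "complex poly \<Rightarrow> nat \<Rightarrow> nat \<Rightarrow> real" where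
  "edge_slope p a b = (log_coeff p b - log_coeff p a) / (real b - real a)"

lemma below_hull_edge:
  assumes "hull_edge p a b" "j \<in> support p"
  shows "log_coeff p j \<le> log_coeff p a + edge_slope p a b * (real j - a)"
  using support_below_edge[of a p b j] assms by (simp add: hull_edge_def edge_slope_def)

lemma hull_edgeD:
  assumes "hull_edge p a b"
  shows "a < b" "b \<le> degree p" "a \<in> support p" "b \<in> support p"
  using assms by (auto simp: hull_edge_def hull_vertices_iff)

text \<open>The edge runs from the last vertex before \<open>j\<close> to the first vertex at or
  after it. The interval is open on the left because the root with number \<open>j\<close> belongs
  to the edge with \<open>a < j \<le> b\<close>.\<close>

lemma hull_edge_cover:
  assumes "coeff p 0 \<noteq> 0" "1 \<le> j" "j \<le> degree p"
  obtains a b where "hull_edge p a b" "a < j" "j \<le> b"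
proof -
  let ?L = "{k \<in> hull_vertices p. k < j}" and ?U = "{k \<in> hull_vertices p. j \<le> k}"
  have "0 \<in> ?L" "degree p \<in> ?U"
    using end_hull_vertices[OF assms(1)] assms by auto
  moreover have "finite ?L" "finite ?U"
    using finite_hull_vertices by auto
  ultimately have "Max ?L \<in> ?L" "Min ?U \<in> ?U"
    using Max_in[of ?L] Min_in[of ?U] by blast+
  moreover have "k \<le> Max ?L" if "k \<in> ?L" for k
    using that finite_hull_vertices by (intro Max_ge) auto
  moreover have "Min ?U \<le> k" if "k \<in> ?U" for k
    using that finite_hull_vertices by (intro Min_le) auto
  ultimately have "hull_edge p (Max ?L) (Min ?U)"
    unfolding hull_edge_def by (fastforce simp: not_less)
  then show thesis
    using that \<open>Max ?L \<in> ?L\<close> \<open>Min ?U \<in> ?U\<close> by auto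
qed

text \<open>Block lengths are gaps of \<open>ks\<close>, so they telescope, and block
  \<open>l\<close> fills exactly the positions from \<open>ks ! (l - 1)\<close> up to but excluding
  \<open>ks ! l\<close>.\<close>

lemma concat_replicate_gaps:
  fixes ks :: "nat list" and f :: "nat \<Rightarrow> 'a"
  assumes "sorted_wrt (<) ks" "ks ! 0 = 0" "1 \<le> n" "n \<le> length ks"
  defines "xs \<equiv> \<lambda>n. concat (map (\<lambda>l. replicate (ks ! l - ks ! (l - 1)) (f l)) [1..<n])"
  shows "length (xs n) = ks ! (n - 1) \<and>
    (\<forall>l i. 1 \<le> l \<and> l < n \<and> ks ! (l - 1) \<le> i \<and> i < ks ! l \<longrightarrow> xs n ! i = f l)"
  using assms(3,4)
proof (induction n rule: nat_induct_at_least)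
  case base
  then show ?case using assms(2) by (simp add: xs_def)
next
  case (Suc n)
  have le: "ks ! (n - 1) < ks ! n"
    using Suc.hyps Suc.prems sorted_wrt_nth_less[OF assms(1), of "n - 1" n] by simp
  have len: "length (xs n) = ks ! (n - 1)"
    using Suc by simp
  have step: "xs (Suc n) = xs n @ replicate (ks ! n - ks ! (n - 1)) (f n)"
    using Suc.hyps by (simp add: xs_def)
  have "xs (Suc n) ! i = f l" if l: "1 \<le> l" "l < Suc n" and i: "ks ! (l - 1) \<le> i" "i < ks ! l" for l i
  proof (cases "l = n")
    case True
    then show ?thesis
      using i len by (simp add: step nth_append)
  next
    case False
    then have "l < n"
      using l by simp
    then have "ks ! l \<le> ks ! (n - 1)"
      using assms(1) Suc.prems by (cases "l = n - 1") (auto intro!: less_imp_le sorted_wrt_nth_less[of "(<)"])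
    then show ?thesis
      using Suc.IH Suc.prems l i len \<open>l < n\<close> by (simp add: step nth_append)
  qed
  then show ?case
    using len le by (simp add: step)
qed

lemma ttau_hull_edge:
  assumes edge: "hull_edge p a b" and p0: "coeff p 0 \<noteq> 0" and j: "a < j" "j \<le> b"
  shows "ttau p j = exp (- edge_slope p a b)"
proof -
  let ?ks = "vertex_indices p"
  have sorted: "sorted_wrt (<) ?ks"
    unfolding vertex_indices_def by simp
  have ab: "a \<in> set ?ks" "b \<in> set ?ks" "a < b" "set ?ks \<inter> {a<..<b} = {}"
    using edge by (auto simp: hull_edge_def hull_vertices_def)
  obtain l where l: "l < length ?ks" "?ks ! l = b"
    using ab(2) by (auto simp: in_set_conv_nth)
  obtain m where m: "m < length ?ks" "?ks ! m = a"
    using ab(1) by (auto simp: in_set_conv_nth)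
  have mono: "?ks ! i < ?ks ! i'" if "i < i'" "i' < length ?ks" for i i'
    using sorted that by (simp add: sorted_wrt_nth_less)
  have "m < l"
    using mono[of l m] l m ab(3) by (metis linorder_neqE_nat order_less_asym order_less_irrefl)
  \<comment> \<open>As no vertex lies strictly inside the edge, its end points are neighbours in the
    sorted list.\<close>
  have pred: "?ks ! (l - 1) = a"
  proof (cases "m = l - 1")
    case False
    then have "m < l - 1" "l - 1 < l"
      using \<open>m < l\<close> by auto
    then have "a < ?ks ! (l - 1)" "?ks ! (l - 1) < b"
      using mono[of m "l - 1"] mono[of "l - 1" l] l m by auto
    moreover have "?ks ! (l - 1) \<in> set ?ks"
      using l by simp
    ultimately show ?thesis
      using ab(4) by auto
  qed (use m in simp)
  have "0 \<in> set ?ks"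
    using end_hull_vertices(1)[OF p0] by (simp add: hull_vertices_def)
  then have "?ks ! 0 = 0"
    using mono[of 0] by (metis in_set_conv_nth neq0_conv not_less_zero)
  then have "\<forall>l' i. 1 \<le> l' \<and> l' < length ?ks \<and> ?ks ! (l' - 1) \<le> i \<and> i < ?ks ! l' \<longrightarrow>
      trop_root_list p ! i = trop_root p l'"
    using concat_replicate_gaps[OF sorted, of "length ?ks" "trop_root p", THEN conjunct2] l
    unfolding trop_root_list_def trop_mult_def by fastforce
  \<comment> \<open>Roots are numbered from 1 and list positions from 0, which turns
    \<open>a < j \<le> b\<close> into \<open>a \<le> j - 1 < b\<close>.\<close>
  moreover have "a \<le> j - 1" "j - 1 < b"
    using j by auto
  ultimately have "ttau p j = trop_root p l"
    using l pred \<open>m < l\<close> by (simp add: ttau_def)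
  also have "\<dots> = root (b - a) (cmod (coeff p a) / cmod (coeff p b))"
    by (simp only: trop_root_def trop_mult_def pred l(2))
  also have "cmod (coeff p a) / cmod (coeff p b) = exp (log_coeff p a - log_coeff p b)"
    using hull_edgeD[OF edge] by (simp add: log_coeff_def exp_diff)
  also have "\<dots> = exp (- edge_slope p a b) ^ (b - a)"
    using \<open>a < b\<close> by (simp add: edge_slope_def of_nat_diff field_simps flip: exp_of_nat_mult)
  also have "root (b - a) \<dots> = exp (- edge_slope p a b)"
    using \<open>a < b\<close> by (intro real_root_power_cancel) auto
  finally show ?thesis .
qed

lemma ttau_pos:
  assumes "coeff p 0 \<noteq> 0" "1 \<le> j" "j \<le> degree p"
  shows "0 < ttau p j"
  using hull_edge_cover[OF assms] ttau_hull_edge[OF _ assms(1)] by (metis exp_gt_zero)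

text \<open>This is concavity of the upper hull: the left end point of each of the two edges lies
  below the line of the other edge, and adding the two inequalities orders the slopes.\<close>

lemma ttau_mono:
  assumes p0: "coeff p 0 \<noteq> 0" and "1 \<le> i" "i \<le> j" "j \<le> degree p"
  shows "ttau p i \<le> ttau p j"
proof -
  obtain a b where e: "hull_edge p a b" "a < i" "i \<le> b"
    using hull_edge_cover[OF p0, of i] assms by auto
  obtain a' b' where e': "hull_edge p a' b'" "a' < j" "j \<le> b'"
    using hull_edge_cover[OF p0, of j] assms by auto
  \<comment> \<open>Otherwise \<open>a' < a < i \<le> j \<le> b'\<close> would place the vertex
    \<open>a\<close> strictly inside the second edge.\<close>
  have "a \<le> a'"
  proof (rule ccontr)
    assume "\<not> a \<le> a'"
    then have "a \<in> hull_vertices p \<inter> {a'<..<b'}"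
      using e e' assms by (auto simp: hull_edge_def)
    moreover have "hull_vertices p \<inter> {a'<..<b'} = {}"
      using e'(1) by (simp add: hull_edge_def)
    ultimately show False by blast
  qed
  show ?thesis
  proof (cases "a = a'")
    case True
    have "\<not> b < b'" "\<not> b' < b"
      using e(1) e'(1) True by (auto simp: hull_edge_def)
    then have "b = b'" by simp
    then show ?thesis
      using ttau_hull_edge[OF e(1) p0, of i] ttau_hull_edge[OF e'(1) p0, of j] e e' True by simp
  next
    case False
    then have lt: "0 < real a' - a"
      using \<open>a \<le> a'\<close> by simp
    have "log_coeff p a' \<le> log_coeff p a + edge_slope p a b * (real a' - a)"
      using below_hull_edge[OF e(1)] hull_edgeD[OF e'(1)] by simp
    moreover have "log_coeff p a \<le> log_coeff p a' + edge_slope p a' b' * (real a - a')"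
      using below_hull_edge[OF e'(1)] hull_edgeD[OF e(1)] by simp
    ultimately have "edge_slope p a' b' * (real a' - a) \<le> edge_slope p a b * (real a' - a)"
      by (simp add: algebra_simps)
    then have "edge_slope p a' b' \<le> edge_slope p a b"
      using lt by simp
    then show ?thesis
      using ttau_hull_edge[OF e(1) p0, of i] ttau_hull_edge[OF e'(1) p0, of j] e e' by simp
  qed
qed

section \<open>Heights of the upper hull and the min-max weights\<close>

definition hull_value :: "complex poly \<Rightarrow> nat \<Rightarrow> real" where
  "hull_value p i = cmod (coeff p 0) / (\<Prod>j=1..i. ttau p j)"

lemma hull_value_pos:
  assumes "coeff p 0 \<noteq> 0" "i \<le> degree p"
  shows "0 < hull_value p i"
  unfolding hull_value_def using assms by (intro divide_pos_pos prod_pos) (auto intro: ttau_pos)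

lemma hull_value_along_edge:
  assumes edge: "hull_edge p a b" and p0: "coeff p 0 \<noteq> 0" and i: "a \<le> i" "i \<le> b"
  shows "hull_value p i = hull_value p a * exp (edge_slope p a b * (real i - a))"
proof -
  have "{1..i} = {1..a} \<union> {a<..i}"
    using i by auto
  then have "(\<Prod>j=1..i. ttau p j) = (\<Prod>j=1..a. ttau p j) * (\<Prod>j\<in>{a<..i}. ttau p j)"
    by (simp add: prod.union_disjoint ivl_disj_int)
  also have "(\<Prod>j\<in>{a<..i}. ttau p j) = exp (- edge_slope p a b) ^ (i - a)"
    using i ttau_hull_edge[OF edge p0] by simp
  also have "\<dots> = inverse (exp (edge_slope p a b * (real i - a)))"
    using i by (simp add: of_nat_diff mult.commute flip: exp_of_nat_mult exp_minus)
  finally show ?thesis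
    by (simp add: hull_value_def divide_inverse mult.assoc)
qed

text \<open>Induction over the vertices from the left, starting with the empty product at 0: the
  roots of the edge ending at \<open>b\<close> carry the value from its left end point to
  \<open>b\<close>.\<close>

lemma hull_value_vertex:
  assumes p0: "coeff p 0 \<noteq> 0" and "b \<in> hull_vertices p"
  shows "hull_value p b = cmod (coeff p b)"
  using assms(2)
proof (induction b rule: less_induct)
  case (less b)
  show ?case
  proof (cases "b = 0")
    case False
    have "b \<le> degree p" "coeff p b \<noteq> 0"
      using less.prems by (auto simp: hull_vertices_iff)
    then obtain a b' where e: "hull_edge p a b'" "a < b" "b \<le> b'"
      using hull_edge_cover[OF p0, of b] False by auto
    \<comment> \<open>A vertex in the interior of an edge is impossible.\<close>
    then have "b' = b"
      using less.prems by (auto simp: hull_edge_def)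
    have "hull_value p a = exp (log_coeff p a)"
      using less.IH[OF e(2)] e(1) hull_edgeD(3)[OF e(1)] by (simp add: hull_edge_def log_coeff_def)
    then have "hull_value p b = exp (log_coeff p a + edge_slope p a b * (real b - a))"
      using hull_value_along_edge[OF e(1) p0, of b] e \<open>b' = b\<close> by (simp add: exp_add)
    also have "\<dots> = exp (log_coeff p b)"
      using e by (simp add: edge_slope_def)
    finally show ?thesis
      using \<open>coeff p b \<noteq> 0\<close> by (simp add: log_coeff_def)
  qed (simp add: hull_value_def)
qed

lemma hull_value_edge:
  assumes "hull_edge p a b" and p0: "coeff p 0 \<noteq> 0" and "a \<le> i" "i \<le> b"
  shows "hull_value p i = exp (log_coeff p a + edge_slope p a b * (real i - a))"
  using hull_value_along_edge[OF assms] hull_value_vertex[OF p0, of a] hull_edgeD(3)[OF assms(1)] assms(1)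
  by (simp add: exp_add log_coeff_def hull_edge_def)

lemma hull_edge_cover':
  assumes "coeff p 0 \<noteq> 0" "1 \<le> degree p" "i \<le> degree p"
  obtains a b where "hull_edge p a b" "a \<le> i" "i \<le> b"
proof -
  \<comment> \<open>Index 0 lies in no left-open interval; the edge covering 1 starts there.\<close>
  obtain a b where "hull_edge p a b" "a < max 1 i" "max 1 i \<le> b"
    using hull_edge_cover[OF assms(1), of "max 1 i"] assms by auto
  then show thesis
    using that[of a b] by (cases "i = 0") auto
qed

lemma norm_coeff_le_hull_value:
  assumes "coeff p 0 \<noteq> 0" "1 \<le> degree p" "i \<le> degree p"
  shows "cmod (coeff p i) \<le> hull_value p i"
proof (cases "coeff p i = 0")
  case True
  then show ?thesis
    using hull_value_pos[of p i] assms by simp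
next
  case False
  obtain a b where e: "hull_edge p a b" "a \<le> i" "i \<le> b"
    using hull_edge_cover'[OF assms] .
  have "cmod (coeff p i) = exp (log_coeff p i)"
    using False by (simp add: log_coeff_def)
  also have "\<dots> \<le> hull_value p i"
    using below_hull_edge[OF e(1), of i] False assms by (simp add: hull_value_edge[OF e(1) assms(1) e(2,3)])
  finally show ?thesis .
qed

text \<open>Along an edge, the logarithm of \<open>hull_value p i * cmod z ^ i\<close> is affine in
  \<open>i\<close>, so it is bounded by its value at one of the end points, where the hull value is
  the modulus of a coefficient.\<close>

lemma hull_value_dominated_by_term:
  assumes p0: "coeff p 0 \<noteq> 0" and "1 \<le> degree p" "i \<le> degree p" and z: "z \<noteq> 0"
  shows "\<exists>k\<le>degree p. hull_value p i * cmod z ^ i \<le> cmod (coeff p k * z ^ k)"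
proof -
  obtain a b where e: "hull_edge p a b" "a \<le> i" "i \<le> b"
    using hull_edge_cover'[OF assms(1-3)] .
  define x where "x = ln (cmod z)"
  let ?s = "edge_slope p a b"
  have zx: "cmod z ^ n = exp (x * n)" for n
    using z by (simp add: x_def exp_of_nat2_mult)
  have val: "hull_value p i * cmod z ^ i = exp (log_coeff p a + x * a + (?s + x) * (real i - a))"
    unfolding hull_value_edge[OF e(1) p0 e(2,3)] zx exp_add[symmetric] by (simp add: algebra_simps)
  have vertex: "cmod (coeff p k * z ^ k) = exp (log_coeff p k + x * k)" if "k \<in> support p" for k
    using that by (simp add: norm_mult norm_power zx exp_add log_coeff_def)
  have sb: "log_coeff p b = log_coeff p a + ?s * (real b - a)"
    using hull_edgeD(1)[OF e(1)] by (simp add: edge_slope_def)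
  \<comment> \<open>The sign of the slope \<open>?s + x\<close> decides whether \<open>a\<close> or
    \<open>b\<close> dominates.\<close>
  have "(?s + x) * (real i - a) \<le> 0 \<or> (?s + x) * (real i - a) \<le> (?s + x) * (real b - a)"
    using e(2,3) by (cases "?s + x \<ge> 0") (auto intro: mult_left_mono simp: mult_nonpos_nonneg)
  then have "hull_value p i * cmod z ^ i \<le> cmod (coeff p a * z ^ a) \<or>
      hull_value p i * cmod z ^ i \<le> cmod (coeff p b * z ^ b)"
    using hull_edgeD[OF e(1)] unfolding val by (simp add: vertex sb algebra_simps)
  then show ?thesis
    using hull_edgeD(1,2)[OF e(1)] by (meson less_imp_le order_trans)
qed

lemma hull_value_le_minmax_weight:
  assumes p0: "coeff p 0 \<noteq> 0" and "1 \<le> degree p" "i \<le> degree p"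
  shows "hull_value p i \<le> minmax_weight p i"
proof -
  \<comment> \<open>The parameter \<open>c\<close> unites both branches of the weight: it is 1 when
    the coefficient vanishes and its modulus otherwise.\<close>
  have bound: "hull_value p i / c \<le> (INF z\<in>{z. cmod z > 0}.
      MAX j\<in>{0..degree p}. cmod (coeff p j * z ^ j) / (c * cmod z ^ i))" if "0 < c" for c
  proof (rule cINF_greatest)
    show "{z. cmod z > 0} \<noteq> {}"
      by (auto intro: exI[of _ 1])
    fix z assume "z \<in> {z. cmod z > 0}"
    then have z: "z \<noteq> 0" by auto
    obtain k where k: "k \<le> degree p" "hull_value p i * cmod z ^ i \<le> cmod (coeff p k * z ^ k)"
      using hull_value_dominated_by_term[OF assms z] by blast
    have "hull_value p i / c = hull_value p i * cmod z ^ i / (c * cmod z ^ i)"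
      using z by simp
    also have "\<dots> \<le> cmod (coeff p k * z ^ k) / (c * cmod z ^ i)"
      using k(2) that by (intro divide_right_mono) auto
    also have "\<dots> \<le> (MAX j\<in>{0..degree p}. cmod (coeff p j * z ^ j) / (c * cmod z ^ i))"
      using k(1) by (intro Max_ge) auto
    finally show "hull_value p i / c \<le> \<dots>" .
  qed
  show ?thesis
  proof (cases "coeff p i = 0")
    case True
    then show ?thesis
      using bound[of 1] by (simp add: minmax_weight_def minmax_gamma_def)
  next
    case False
    then have "hull_value p i / cmod (coeff p i) \<le> minmax_gamma p i"
      using bound[of "cmod (coeff p i)"] by (simp add: minmax_gamma_def norm_mult norm_power)
    then show ?thesis
      using False by (simp add: minmax_weight_def pos_divide_le_eq)
  qed
qed

subsection \<open>The determinant of the scaled companion pencil\<close>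

lemma det_mat_diag: "det (mat_diag n f) = (\<Prod>i<n. f i)"
proof -
  have "upper_triangular (mat_diag n f)"
    by (auto simp: upper_triangular_def mat_diag_def)
  then have "det (mat_diag n f) = (\<Prod>i<n. mat_diag n f $$ (i, i))"
    by (rule det_upper_triangular_prod) simp
  then show ?thesis
    by (simp add: mat_diag_def)
qed

lemma companion_carrier [simp]:
  "companion_A p \<in> carrier_mat (degree p + 1) (degree p + 1)"
  "companion_B p \<in> carrier_mat (degree p + 1) (degree p + 1)"
  by (simp_all add: companion_A_def companion_B_def del: One_nat_def)

text \<open>
  Replacing the last column of the pencil by its product with \<open>(z\<^sup>d, \<dots>, z, 1)\<close> does not change the
  determinant and turns that column into a multiple of the first unit vector.
\<close>

lemma det_companion_pencil:
  "det (companion_A p - z \<cdot>\<^sub>m companion_B p) = (- 1) ^ degree p * poly p z"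
proof -
  define d where "d = degree p"
  define X where "X = companion_A p - z \<cdot>\<^sub>m companion_B p"
  define U where "U = Matrix.mat (Suc d) (Suc d) (\<lambda>(i, j). if j = d then z ^ (d - i) else if i = j then 1 else 0)"
  have X: "X \<in> carrier_mat (Suc d) (Suc d)"
    using minus_carrier_mat[OF smult_carrier_mat[OF companion_carrier(2)[of p]]] by (simp add: X_def d_def)
  have U: "U \<in> carrier_mat (Suc d) (Suc d)"
    by (simp add: U_def)
  have X_entry: "X $$ (r, c) = (if r = 0 then coeff p (d - c) else if r = Suc c then 1 else if r = c then - z else 0)"
    if "r < Suc d" "c < Suc d" for r c
    using that by (auto simp: X_def companion_A_def companion_B_def mat_diag_def d_def)
  have "upper_triangular U"
    by (auto simp: upper_triangular_def U_def)
  then have "det U = (\<Prod>i<Suc d. U $$ (i, i))"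
    using U by (simp add: det_upper_triangular_prod)
  also have "\<dots> = 1"
    by (intro prod.neutral) (auto simp: U_def)
  finally have det_U: "det U = 1" .
  have XU: "X * U \<in> carrier_mat (Suc d) (Suc d)"
    using X U by simp
  have entry: "(X * U) $$ (r, c) = (\<Sum>k<Suc d. X $$ (r, k) * U $$ (k, c))" if "r < Suc d" "c < Suc d" for r c
    using that X U by (simp add: scalar_prod_def lessThan_atLeast0)
  have col: "(X * U) $$ (r, c) = X $$ (r, c)" if "r < Suc d" "c < d" for r c
  proof -
    have "(\<Sum>k<Suc d. X $$ (r, k) * U $$ (k, c)) = (\<Sum>k<Suc d. if k = c then X $$ (r, k) else 0)"
      using that by (intro sum.cong) (auto simp: U_def)
    then show ?thesis
      using that by (simp add: entry)
  qed
  have last: "(X * U) $$ (r, d) = (if r = 0 then poly p z else 0)" if r: "r < Suc d" for r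
  proof (cases r)
    case 0
    have "(X * U) $$ (r, d) = (\<Sum>k<Suc d. coeff p (d - k) * z ^ (d - k))"
      unfolding entry[OF r lessI] using 0 by (intro sum.cong) (auto simp: X_entry U_def)
    also have "\<dots> = (\<Sum>k\<le>d. coeff p k * z ^ k)"
      by (rule sum.reindex_bij_witness[of _ "\<lambda>k. d - k" "\<lambda>k. d - k"]) auto
    finally show ?thesis
      by (simp add: 0 poly_altdef d_def)
  next
    case (Suc s)
    \<comment> \<open>A lower row has just the entries 1 in column \<open>s\<close> and
      \<open>- z\<close> in column \<open>Suc s\<close>, whose contributions cancel.\<close>
    have "(X * U) $$ (r, d) = (\<Sum>k<Suc d. (if k = s then z ^ (d - k) else 0) + (if k = Suc s then - z * z ^ (d - k) else 0))"
      unfolding entry[OF r lessI] using Suc r by (intro sum.cong) (auto simp: X_entry U_def)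
    also have "\<dots> = z ^ (d - s) - z * z ^ (d - Suc s)"
      using Suc r by (simp add: sum.distrib del: sum.lessThan_Suc)
    also have "\<dots> = 0"
    proof -
      have "d - s = Suc (d - Suc s)"
        using Suc r by simp
      then show ?thesis by simp
    qed
    finally show ?thesis
      by (simp add: Suc)
  qed
  have "det X = det (X * U)"
    by (simp add: det_mult[OF X U] det_U)
  also have "\<dots> = (\<Sum>i<Suc d. (X * U) $$ (i, d) * cofactor (X * U) i d)"
    by (rule laplace_expansion_column[OF XU]) simp
  also have "\<dots> = poly p z * cofactor (X * U) 0 d"
    by (subst sum.lessThan_Suc_shift) (simp add: last)
  also have "cofactor (X * U) 0 d = (- 1) ^ d * det (mat_delete (X * U) 0 d)"
    by (simp add: cofactor_def)
  \<comment> \<open>Without the first row and last column the subdiagonal ones become the diagonal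
    and the entries \<open>- z\<close> move above it.\<close>
  also have "det (mat_delete (X * U) 0 d) = 1"
  proof -
    let ?Y = "mat_delete (X * U) 0 d"
    have Y: "?Y \<in> carrier_mat d d"
      using XU by (metis mat_delete_carrier diff_Suc_1)
    have Y_entry: "?Y $$ (i, j) = X $$ (Suc i, j)" if "i < d" "j < d" for i j
      using that XU X U col[of "Suc i" j] by (simp add: mat_delete_def)
    have "upper_triangular ?Y"
      using Y by (auto simp: upper_triangular_def Y_entry X_entry)
    then have "det ?Y = (\<Prod>i<d. ?Y $$ (i, i))"
      using Y by (simp add: det_upper_triangular_prod)
    also have "\<dots> = 1"
      by (intro prod.neutral) (auto simp: Y_entry X_entry)
    finally show ?thesis .
  qed
  finally show ?thesis
    by (simp add: X_def d_def mult.commute)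
qed

section \<open>The diagonal scalings, through products of the largest tropical roots\<close>

definition tail_prod :: "complex poly \<Rightarrow> nat \<Rightarrow> real" where
  "tail_prod p c = (\<Prod>j=degree p + 1 - c..degree p. ttau p j)"

lemma tail_prod_pos:
  assumes "coeff p 0 \<noteq> 0" "c \<le> degree p"
  shows "0 < tail_prod p c"
  unfolding tail_prod_def using assms by (intro prod_pos) (auto intro: ttau_pos)

lemma tail_prod_Suc:
  assumes "c < degree p"
  shows "tail_prod p (Suc c) = ttau p (degree p - c) * tail_prod p c"
  using assms unfolding tail_prod_def
  by (subst prod.atLeast_Suc_atMost) (auto simp: Suc_diff_le)

text \<open>The product of all roots splits into the first \<open>degree p - c\<close> and the last
  \<open>c\<close>, and the last index is a vertex, so the hull value there is the modulus of the
  leading coefficient.\<close>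

lemma lead_coeff_tail_prod:
  assumes p0: "coeff p 0 \<noteq> 0" and "c \<le> degree p"
  shows "cmod (lead_coeff p) * tail_prod p c = hull_value p (degree p - c)"
proof -
  let ?d = "degree p"
  have "(\<Prod>j=1..?d. ttau p j) = (\<Prod>j=1..?d - c. ttau p j) * tail_prod p c"
  proof -
    have "{1..?d} = {1..?d - c} \<union> {?d + 1 - c..?d}"
      using assms(2) by auto
    then show ?thesis
      unfolding tail_prod_def using assms(2) by (simp only:) (subst prod.union_disjoint, auto)
  qed
  moreover have "hull_value p ?d = cmod (lead_coeff p)"
    using hull_value_vertex[OF p0 end_hull_vertices(2)[OF p0]] .
  moreover have "(\<Prod>j=1..?d - c. ttau p j) \<noteq> 0"
    using ttau_pos[OF p0] by (force simp: prod_zero_iff)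
  ultimately show ?thesis
    using tail_prod_pos[OF assms] by (simp add: hull_value_def field_simps)
qed

text \<open>Row \<open>r > 0\<close> carries the inverse of the right weight of column
  \<open>r - 1\<close>, so the subdiagonal ones of the companion matrix survive scaling.\<close>

definition left_weight :: "complex poly \<Rightarrow> nat \<Rightarrow> real" where
  "left_weight p r = (if r = 0 then 1 / cmod (lead_coeff p) else tail_prod p (r - 1))"

lemma scale_left_eq: "scale_left p = mat_diag (degree p + 1) (\<lambda>r. complex_of_real (left_weight p r))"
proof -
  have "degree p + 1 - (r - 1) = degree p + 2 - r" if "r \<noteq> 0" for r
    using that by auto
  then have "(if r = 0 then 1 / cmod (lead_coeff p) else \<Prod>j = degree p + 2 - r..degree p. ttau p j) = left_weight p r" for r
    unfolding left_weight_def tail_prod_def by presburger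
  then show ?thesis
    unfolding scale_left_def by simp
qed

lemma scale_right_eq: "scale_right p = mat_diag (degree p + 1) (\<lambda>c. complex_of_real (1 / tail_prod p c))"
  by (simp add: scale_right_def tail_prod_def)

lemma scale_carrier [simp]:
  "scale_left p \<in> carrier_mat (degree p + 1) (degree p + 1)"
  "scale_right p \<in> carrier_mat (degree p + 1) (degree p + 1)"
  by (simp_all add: scale_left_def scale_right_def del: One_nat_def)

lemma hat_carrier [simp]:
  "A_hat p \<in> carrier_mat (degree p + 1) (degree p + 1)"
  "B_hat p \<in> carrier_mat (degree p + 1) (degree p + 1)"
  unfolding A_hat_def B_hat_def by (meson mult_carrier_mat companion_carrier scale_carrier)+

lemma scaled_entry:
  assumes "M \<in> carrier_mat (degree p + 1) (degree p + 1)" "r \<le> degree p" "c \<le> degree p"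
  shows "(scale_left p * M * scale_right p) $$ (r, c) =
    complex_of_real (left_weight p r / tail_prod p c) * M $$ (r, c)"
  using assms
  by (simp add: scale_left_eq scale_right_eq mat_diag_mult_left[of _ _ "degree p + 1"] mat_diag_mult_right[of _ "degree p + 1"] del: One_nat_def)

text \<open>Scaling turns the first row into coefficients divided by hull values, in modulus; the
  subdiagonal stays 1.\<close>

lemma norm_A_hat_le:
  assumes p0: "coeff p 0 \<noteq> 0" and d: "1 \<le> degree p" and "r \<le> degree p" "c \<le> degree p"
  shows "cmod (A_hat p $$ (r, c)) \<le> 1"
proof -
  have pos: "0 < tail_prod p c" "0 < cmod (lead_coeff p)"
    using tail_prod_pos[OF p0] assms by auto
  have entry: "A_hat p $$ (r, c) = complex_of_real (left_weight p r / tail_prod p c) * companion_A p $$ (r, c)"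
    unfolding A_hat_def by (rule scaled_entry[OF companion_carrier(1)]) (use assms in auto)
  consider "r = 0" | "r = c + 1" | "r \<noteq> 0" "r \<noteq> c + 1" by blast
  then show ?thesis
  proof cases
    case 1
    then have "cmod (A_hat p $$ (r, c)) = cmod (coeff p (degree p - c)) / (cmod (lead_coeff p) * tail_prod p c)"
      unfolding entry using pos assms by (simp add: companion_A_def left_weight_def norm_mult norm_divide)
    also have "\<dots> \<le> 1"
      using norm_coeff_le_hull_value[OF p0 d, of "degree p - c"] pos assms
      by (simp add: lead_coeff_tail_prod divide_le_eq_1 hull_value_pos)
    finally show ?thesis .
  qed (unfold entry, use pos assms in \<open>auto simp: companion_A_def left_weight_def\<close>)
qed

text \<open>The value 0 for the first column makes its majorant constant in \<open>z\<close>: this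
  column carries the artificial eigenvalue at infinity.\<close>

definition col_weight :: "complex poly \<Rightarrow> nat \<Rightarrow> real" where
  "col_weight p c = (if c = 0 then 0 else inverse (ttau p (degree p + 1 - c)))"

text \<open>On the diagonal, consecutive tail products leave the reciprocal of a single
  root.\<close>

lemma norm_B_hat_le:
  assumes p0: "coeff p 0 \<noteq> 0" and "r \<le> degree p" "c \<le> degree p"
  shows "cmod (B_hat p $$ (r, c)) \<le> col_weight p c"
proof -
  have entry: "B_hat p $$ (r, c) = complex_of_real (left_weight p r / tail_prod p c) * companion_B p $$ (r, c)"
    unfolding B_hat_def by (rule scaled_entry[OF companion_carrier(2)]) (use assms in auto)
  have nonneg: "0 \<le> col_weight p c"
  proof (cases "c = 0")
    case False
    then have "0 < ttau p (degree p + 1 - c)"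
      using assms by (intro ttau_pos[OF p0]) auto
    then show ?thesis
      by (simp add: col_weight_def)
  qed (simp add: col_weight_def)
  show ?thesis
  proof (cases "r = c \<and> c \<noteq> 0")
    case True
    then obtain c' where c': "c = Suc c'"
      by (cases c) auto
    have "tail_prod p c = ttau p (degree p - c') * tail_prod p c'" "0 < tail_prod p c'" "0 < ttau p (degree p - c')"
      using tail_prod_Suc[of c' p] tail_prod_pos[OF p0, of c'] ttau_pos[OF p0, of "degree p - c'"] assms c' by auto
    then show ?thesis
      unfolding entry using True assms c'
      by (simp add: companion_B_def mat_diag_def left_weight_def col_weight_def norm_divide norm_mult field_simps)
  qed (unfold entry, use nonneg assms in \<open>auto simp: companion_B_def mat_diag_def\<close>)
qed

lemma det_scaled_pencil:
  assumes p0: "coeff p 0 \<noteq> 0"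
  shows "det (lin_pencil (degree p + 1) (A_hat p) (B_hat p)) =
    smult (complex_of_real ((- 1) ^ degree p / cmod (coeff p 0))) p"
proof -
  let ?d = "degree p"
  \<comment> \<open>The weight of row \<open>c + 1\<close> cancels that of column \<open>c\<close>;
    only row 0 and the last column remain.\<close>
  have "(\<Prod>i<?d + 1. left_weight p i) * (\<Prod>c<?d + 1. 1 / tail_prod p c) =
      1 / (cmod (lead_coeff p) * tail_prod p ?d) * (\<Prod>c<?d. tail_prod p c * (1 / tail_prod p c))"
  proof -
    have "(\<Prod>i<Suc ?d. left_weight p i) = left_weight p 0 * (\<Prod>i<?d. left_weight p (Suc i))"
      by (rule prod.lessThan_Suc_shift)
    then show ?thesis
      unfolding prod.distrib by (simp add: left_weight_def)
  qed
  also have "(\<Prod>c<?d. tail_prod p c * (1 / tail_prod p c)) = 1"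
  proof (intro prod.neutral ballI)
    fix c assume "c \<in> {..<?d}"
    then show "tail_prod p c * (1 / tail_prod p c) = 1"
      using tail_prod_pos[OF p0, of c] by simp
  qed
  also have "cmod (lead_coeff p) * tail_prod p ?d = cmod (coeff p 0)"
    using lead_coeff_tail_prod[OF p0, of ?d] by (simp add: hull_value_def)
  finally have weights: "(\<Prod>i<?d + 1. left_weight p i) * (\<Prod>c<?d + 1. 1 / tail_prod p c) = 1 / cmod (coeff p 0)"
    by simp
  have "poly (det (lin_pencil (?d + 1) (A_hat p) (B_hat p))) z =
      poly (smult (complex_of_real ((- 1) ^ ?d / cmod (coeff p 0))) p) z" for z
  proof -
    let ?X = "companion_A p - z \<cdot>\<^sub>m companion_B p"
    have X: "?X \<in> carrier_mat (?d + 1) (?d + 1)"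
      by (intro minus_carrier_mat smult_carrier_mat companion_carrier)
    have "A_hat p - z \<cdot>\<^sub>m B_hat p = scale_left p * ?X * scale_right p"
    proof (rule eq_matI)
      fix i j assume "i < dim_row (scale_left p * ?X * scale_right p)" "j < dim_col (scale_left p * ?X * scale_right p)"
      then have ij: "i \<le> ?d" "j \<le> ?d"
        using scale_carrier[of p] by auto
      have "(A_hat p - z \<cdot>\<^sub>m B_hat p) $$ (i, j) = A_hat p $$ (i, j) - z * B_hat p $$ (i, j)"
        using ij hat_carrier[of p] by simp
      also have "\<dots> = complex_of_real (left_weight p i / tail_prod p j) * ?X $$ (i, j)"
        unfolding A_hat_def B_hat_def using ij companion_carrier[of p]
        by (simp add: scaled_entry algebra_simps del: of_real_divide)
      also have "\<dots> = (scale_left p * ?X * scale_right p) $$ (i, j)"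
        using scaled_entry[OF X ij] by simp
      finally show "(A_hat p - z \<cdot>\<^sub>m B_hat p) $$ (i, j) = (scale_left p * ?X * scale_right p) $$ (i, j)" .
    qed (use hat_carrier[of p] scale_carrier[of p] in auto)
    then have "det (A_hat p - z \<cdot>\<^sub>m B_hat p) = det (scale_left p) * det ?X * det (scale_right p)"
      using X scale_carrier[of p] by (simp add: det_mult[of _ "?d + 1"] del: One_nat_def)
    also have "\<dots> = complex_of_real ((\<Prod>i<?d + 1. left_weight p i) * (\<Prod>c<?d + 1. 1 / tail_prod p c)) * det ?X"
      by (simp only: scale_left_eq scale_right_eq det_mat_diag of_real_prod of_real_mult mult_ac)
    also have "\<dots> = complex_of_real ((- 1) ^ ?d / cmod (coeff p 0)) * poly p z"
      unfolding weights by (simp add: det_companion_pencil)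
    finally show ?thesis
      unfolding poly_det_lin_pencil[OF hat_carrier] by simp
  qed
  then show ?thesis
    using poly_eq_poly_eq_iff by blast
qed

subsection \<open>The backward error\<close>

definition pencil_majorant :: "complex poly \<Rightarrow> nat \<Rightarrow> real poly" where
  "pencil_majorant p c = [:1, col_weight p c:]"

lemma coeff_prod_pencil_majorant_le:
  assumes p0: "coeff p 0 \<noteq> 0" and i: "i \<le> degree p"
  shows "coeff (\<Prod>c<degree p + 1. pencil_majorant p c) i \<le> 2 ^ degree p * (hull_value p i / cmod (coeff p 0))"
proof -
  let ?d = "degree p"
  have "(\<Prod>c<?d + 1. pencil_majorant p c) = (\<Prod>c<?d. pencil_majorant p (Suc c))"
    by (simp add: prod.lessThan_Suc_shift pencil_majorant_def col_weight_def one_pCons[symmetric] del: prod.lessThan_Suc)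
  \<comment> \<open>Reversing the columns lists the roots in increasing order, hence their
    reciprocals in decreasing order.\<close>
  also have "\<dots> = (\<Prod>j=1..?d. [:1, inverse (ttau p j):])"
    by (rule prod.reindex_bij_witness[of _ "\<lambda>j. ?d - j" "\<lambda>c. ?d - c"])
      (auto simp: pencil_majorant_def col_weight_def)
  also have "coeff \<dots> i \<le> 2 ^ ?d * (\<Prod>j=1..i. inverse (ttau p j))"
    using coeff_prod_linear_le[of ?d "\<lambda>j. inverse (ttau p j)" i] i ttau_pos[OF p0] ttau_mono[OF p0]
    by (auto intro!: le_imp_inverse_le)
  also have "(\<Prod>j=1..i. inverse (ttau p j)) = hull_value p i / cmod (coeff p 0)"
    using p0 by (simp add: hull_value_def inverse_eq_divide prod_dividef)
  finally show ?thesis .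
qed

text \<open>The factor in \<open>q\<close> inverts the constant of \<open>det_scaled_pencil\<close>,
  so that the unperturbed pencil reproduces \<open>p\<close>. The constants
  \<open>fact n * 2 ^ n\<close> come from the determinant and \<open>2 ^ degree p\<close> from the
  coefficients of the majorant.\<close>

lemma perturbed_pencil_coeff:
  assumes p0: "coeff p 0 \<noteq> 0" and d: "1 \<le> degree p"
    and \<Delta>A: "\<Delta>A \<in> carrier_mat (degree p + 1) (degree p + 1)"
      "\<And>r c. r \<le> degree p \<Longrightarrow> c \<le> degree p \<Longrightarrow> cmod (\<Delta>A $$ (r, c)) \<le> \<delta>"
    and \<Delta>B: "\<Delta>B \<in> carrier_mat (degree p + 1) (degree p + 1)"
      "\<And>r c. r \<le> degree p \<Longrightarrow> c \<le> degree p \<Longrightarrow> cmod (\<Delta>B $$ (r, c)) \<le> \<delta> * col_weight p c"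
    and \<delta>: "0 \<le> \<delta>" "\<delta> \<le> 1"
  defines "q \<equiv> smult (complex_of_real ((- 1) ^ degree p * cmod (coeff p 0)))
    (det (lin_pencil (degree p + 1) (A_hat p + \<Delta>A) (B_hat p + \<Delta>B)))"
  assumes i: "i \<le> degree p"
  shows "cmod (coeff p i - coeff q i) \<le>
    fact (degree p + 1) * 2 ^ (degree p + 1) * 2 ^ degree p * \<delta> * hull_value p i"
proof -
  let ?n = "degree p + 1"
  let ?M = "lin_pencil ?n (A_hat p) (B_hat p)" and ?N = "lin_pencil ?n (A_hat p + \<Delta>A) (B_hat p + \<Delta>B)"
  let ?\<alpha> = "complex_of_real ((- 1) ^ degree p * cmod (coeff p 0))"
  let ?K = "fact ?n * 2 ^ ?n * \<delta> :: real"
  have maj: "?M $$ (r, c) \<preceq>m pencil_majorant p c" if "r < ?n" "c < ?n" for r c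
    using norm_A_hat_le[OF p0 d, of r c] norm_B_hat_le[OF p0, of r c] that
    by (simp add: majorized_def lin_pencil_def pencil_majorant_def coeff_pCons split: nat.split)
  have diff: "?N $$ (r, c) - ?M $$ (r, c) \<preceq>m smult \<delta> (pencil_majorant p c)" if "r < ?n" "c < ?n" for r c
    using \<Delta>A(2)[of r c] \<Delta>B(2)[of r c] that \<Delta>A(1) \<Delta>B(1) hat_carrier[of p]
    by (simp add: majorized_def lin_pencil_def pencil_majorant_def coeff_pCons split: nat.split)
  have "det ?N - det ?M \<preceq>m smult ?K (\<Prod>c<?n. pencil_majorant p c)"
    by (rule det_perturb_majorized[OF lin_pencil_carrier lin_pencil_carrier \<delta> maj diff])
  then have "cmod (coeff (det ?N - det ?M) i) \<le> ?K * coeff (\<Prod>c<?n. pencil_majorant p c) i"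
    using majorizedD by fastforce
  also have "\<dots> \<le> ?K * (2 ^ degree p * (hull_value p i / cmod (coeff p 0)))"
    using \<delta> by (intro mult_left_mono coeff_prod_pencil_majorant_le[OF p0 i]) simp
  finally have bound: "cmod (coeff (det ?N - det ?M) i) \<le> \<dots>" .
  have "(- 1) ^ degree p * cmod (coeff p 0) * ((- 1) ^ degree p / cmod (coeff p 0)) = 1"
    using p0 by (cases "even (degree p)") auto
  then have "?\<alpha> * complex_of_real ((- 1) ^ degree p / cmod (coeff p 0)) = 1"
    by (metis of_real_1 of_real_mult)
  then have "p = smult ?\<alpha> (det ?M)"
    unfolding det_scaled_pencil[OF p0] by (metis smult_1_left smult_smult)
  then have "coeff p i = ?\<alpha> * coeff (det ?M) i"
    by (metis coeff_smult)
  then have "coeff p i - coeff q i = - (?\<alpha> * coeff (det ?N - det ?M) i)"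
    by (simp add: q_def algebra_simps)
  then have "cmod (coeff p i - coeff q i) = cmod (coeff p 0) * cmod (coeff (det ?N - det ?M) i)"
    by (simp add: norm_mult norm_power del: coeff_diff)
  also have "\<dots> \<le> cmod (coeff p 0) * (?K * (2 ^ degree p * (hull_value p i / cmod (coeff p 0))))"
    by (intro mult_left_mono bound) simp
  finally show ?thesis
    using p0 by (simp add: mult_ac)
qed

lemma elem_backward_error_le:
  assumes w: "\<And>i. i \<le> degree p \<Longrightarrow> 0 < w i" and \<mu>: "\<mu> \<noteq> 0"
    and le: "\<And>i. i \<le> degree p \<Longrightarrow>
      cmod (coeff p i - \<mu> * coeff (poly_from_roots (lead_coeff p) zs) i) \<le> e * w i"
  shows "elem_backward_error w p zs \<le> e"
proof -
  let ?f = "\<lambda>\<mu>. MAX i\<in>{0..degree p}.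
        cmod (coeff p i - \<mu> * coeff (poly_from_roots (lead_coeff p) zs) i) / w i"
  \<comment> \<open>A lower bound over all multipliers is needed for the real infimum to lie below
    the chosen value.\<close>
  have "0 \<le> ?f \<nu>" for \<nu>
  proof -
    have "0 \<le> cmod (coeff p 0 - \<nu> * coeff (poly_from_roots (lead_coeff p) zs) 0) / w 0"
      using w[of 0] by simp
    also have "\<dots> \<le> ?f \<nu>"
      by (intro Max_ge) auto
    finally show ?thesis .
  qed
  then have "elem_backward_error w p zs \<le> ?f \<mu>"
    unfolding elem_backward_error_def using \<mu> by (intro cINF_lower bdd_belowI2[of _ 0]) auto
  also have "\<dots> \<le> e"
    using le w by (intro Max.boundedI) (auto simp: pos_divide_le_eq)
  finally show ?thesis .
qed

lemma backward_error_bound: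
  assumes p0: "coeff p 0 \<noteq> 0" and d: "1 \<le> degree p"
    and qz: "qz_assumption C \<epsilon> qz p" and roots: "computes_roots qz p zs"
    and \<epsilon>: "0 < \<epsilon>" and K: "fact (degree p + 1) * 2 ^ (degree p + 1) * 2 ^ degree p * \<bar>C\<bar> \<le> K"
    and small: "K * \<epsilon> < 1"
  shows "elem_backward_error (minmax_weight p) p zs \<le> K * \<epsilon>"
proof -
  let ?d = "degree p"
  let ?m = "fact (?d + 1) * 2 ^ (?d + 1) * 2 ^ ?d :: real"
  obtain G S' T' where G: "deflating_rotation p G" "qz_deflated qz p G = (S', T')"
    and zs: "zs = map (\<lambda>k. S' $$ (k, k) / T' $$ (k, k)) [0..<?d]"
    using roots unfolding computes_roots_def by blast
  obtain \<Delta>A \<Delta>B S T where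
    \<Delta>A: "\<Delta>A \<in> carrier_mat (?d + 1) (?d + 1)" "\<forall>r\<le>?d. \<forall>c\<le>?d. cmod (\<Delta>A $$ (r, c)) \<le> C * \<epsilon>"
    and \<Delta>B: "\<Delta>B \<in> carrier_mat (?d + 1) (?d + 1)" "\<forall>r\<le>?d. \<Delta>B $$ (r, 0) = 0"
      "\<forall>r\<le>?d. \<forall>c\<in>{1..?d}. cmod (\<Delta>B $$ (r, c)) \<le> C * (inverse (ttau p (?d + 1 - c)) * \<epsilon>)"
    and schur: "generalized_schur_form (?d + 1) (A_hat p + \<Delta>A) (B_hat p + \<Delta>B) S T"
    and T0: "T $$ (0, 0) = 0" and S': "S' = trailing S" and T': "T' = trailing T"
    and T'_nz: "\<forall>k<?d. T' $$ (k, k) \<noteq> 0"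
    using qz G unfolding qz_assumption_def Let_def by blast
  \<comment> \<open>The sign of \<open>C\<close> is not prescribed, but
    \<open>C * \<epsilon>\<close> bounds a modulus.\<close>
  have "0 \<le> C * \<epsilon>"
    using \<Delta>A(2) norm_ge_zero order_trans by blast
  have m: "1 \<le> ?m"
  proof -
    have "1 * (1 * 1) \<le> fact (?d + 1) * (2 ^ (?d + 1) * 2 ^ ?d :: real)"
      by (intro mult_mono one_le_power fact_ge_1) auto
    then show ?thesis
      by (simp only: mult.assoc mult_1)
  qed
  have "C * \<epsilon> \<le> \<bar>C\<bar> * \<epsilon>"
    using \<epsilon> by (intro mult_right_mono) auto
  then have "?m * (C * \<epsilon>) \<le> ?m * (\<bar>C\<bar> * \<epsilon>)"
    using m by (intro mult_left_mono) auto
  also have "\<dots> \<le> K * \<epsilon>"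
    using K \<epsilon> by (simp add: mult_right_mono flip: mult.assoc)
  finally have mK: "?m * (C * \<epsilon>) \<le> K * \<epsilon>" .
  have "1 * (C * \<epsilon>) \<le> ?m * (C * \<epsilon>)"
    using m \<open>0 \<le> C * \<epsilon>\<close> by (rule mult_right_mono)
  with mK small have "C * \<epsilon> \<le> 1" by linarith
  let ?N = "lin_pencil (?d + 1) (A_hat p + \<Delta>A) (B_hat p + \<Delta>B)"
  define \<alpha> where "\<alpha> = complex_of_real ((- 1) ^ ?d * cmod (coeff p 0))"
  define q where "q = smult \<alpha> (det ?N)"
  have close: "cmod (coeff p i - coeff q i) \<le> K * \<epsilon> * hull_value p i" if "i \<le> ?d" for i
  proof -
    have "cmod (\<Delta>B $$ (r, c)) \<le> C * \<epsilon> * col_weight p c" if "r \<le> ?d" "c \<le> ?d" for r c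
      using \<Delta>B(2,3) that by (cases "c = 0") (auto simp: col_weight_def mult_ac)
    then have "cmod (coeff p i - coeff q i) \<le> ?m * (C * \<epsilon>) * hull_value p i"
      unfolding q_def \<alpha>_def using \<Delta>A \<Delta>B(1) \<open>0 \<le> C * \<epsilon>\<close> \<open>C * \<epsilon> \<le> 1\<close> that
      by (intro perturbed_pencil_coeff[OF p0 d]) auto
    also have "\<dots> \<le> K * \<epsilon> * hull_value p i"
      using mK hull_value_pos[OF p0 that] by (intro mult_right_mono) auto
    finally show ?thesis .
  qed
  \<comment> \<open>The hull value at 0 is \<open>cmod (coeff p 0)\<close>, so a relative error
    below 1 keeps this coefficient nonzero. This makes the multiplier \<open>\<mu>\<close>
    nonzero.\<close>
  have "coeff q 0 \<noteq> 0"
  proof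
    assume "coeff q 0 = 0"
    then have "cmod (coeff p 0) \<le> K * \<epsilon> * cmod (coeff p 0)"
      using close[of 0] by (simp add: hull_value_def)
    then show False
      using small p0 by simp
  qed
  have "A_hat p + \<Delta>A \<in> carrier_mat (?d + 1) (?d + 1)" "B_hat p + \<Delta>B \<in> carrier_mat (?d + 1) (?d + 1)"
    using \<Delta>A(1) \<Delta>B(1) by auto
  from generalized_schur_form_det[OF this schur] obtain \<kappa> where
    \<kappa>: "det ?N = smult \<kappa> (\<Prod>k<?d + 1. [:S $$ (k, k), - T $$ (k, k):])"
    and ST: "S \<in> carrier_mat (?d + 1) (?d + 1)" "T \<in> carrier_mat (?d + 1) (?d + 1)" .
  have diag: "S $$ (Suc k, Suc k) = S' $$ (k, k)" "T $$ (Suc k, Suc k) = T' $$ (k, k)" if "k < ?d" for k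
    using ST that by (auto simp: S' T' trailing_def mat_delete_def)
  \<comment> \<open>Strict deflation gives nonzero diagonal entries of \<open>T'\<close>, so each
    factor is a multiple of a monic linear one.\<close>
  have factor: "[:S $$ (Suc k, Suc k), - T $$ (Suc k, Suc k):] =
      smult (- T' $$ (k, k)) [:- (S' $$ (k, k) / T' $$ (k, k)), 1:]" if "k < ?d" for k
    using T'_nz that by (simp add: diag)
  \<comment> \<open>As \<open>T $$ (0, 0) = 0\<close>, the trivial eigenvalue contributes only a
    constant.\<close>
  have "(\<Prod>k<?d + 1. [:S $$ (k, k), - T $$ (k, k):]) =
      [:S $$ (0, 0):] * (\<Prod>k<?d. [:S $$ (Suc k, Suc k), - T $$ (Suc k, Suc k):])"
    by (simp add: prod.lessThan_Suc_shift T0 del: prod.lessThan_Suc)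
  also have "(\<Prod>k<?d. [:S $$ (Suc k, Suc k), - T $$ (Suc k, Suc k):]) =
      (\<Prod>k<?d. smult (- T' $$ (k, k)) [:- (S' $$ (k, k) / T' $$ (k, k)), 1:])"
    by (intro prod.cong factor) auto
  also have "\<dots> = smult (\<Prod>k<?d. - T' $$ (k, k)) (\<Prod>k<?d. [:- (S' $$ (k, k) / T' $$ (k, k)), 1:])"
    by (rule prod_smult)
  also have "(\<Prod>k<?d. [:- (S' $$ (k, k) / T' $$ (k, k)), 1:]) = (\<Prod>z\<leftarrow>zs. [:- z, 1:])"
    unfolding zs atLeast_upt by (subst prod.distinct_set_conv_list) (simp_all add: o_def)
  finally have "q = smult (\<alpha> * \<kappa> * S $$ (0, 0) * (\<Prod>k<?d. - T' $$ (k, k))) (\<Prod>z\<leftarrow>zs. [:- z, 1:])"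
    unfolding q_def \<kappa> by (simp add: mult_ac del: prod.lessThan_Suc)
  moreover have "lead_coeff p \<noteq> 0"
    using p0 by auto
  \<comment> \<open>All constants, divided by the leading coefficient, are absorbed in
    \<open>\<mu>\<close>, over which the backward error minimizes.\<close>
  ultimately obtain \<mu> where \<mu>: "q = smult \<mu> (poly_from_roots (lead_coeff p) zs)"
    unfolding poly_from_roots_def by (metis (no_types, lifting) nonzero_eq_divide_eq smult_smult)
  then have "\<mu> \<noteq> 0"
    using \<open>coeff q 0 \<noteq> 0\<close> by auto
  have weight: "hull_value p i \<le> minmax_weight p i" "0 < minmax_weight p i" if "i \<le> ?d" for i
    using hull_value_le_minmax_weight[OF p0 d that] hull_value_pos[OF p0 that] by auto
  have "0 \<le> K"
    using K m by (meson abs_ge_zero order_trans mult_nonneg_nonneg zero_le_one)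
  show ?thesis
  proof (rule elem_backward_error_le[OF weight(2) \<open>\<mu> \<noteq> 0\<close>])
    fix i assume i: "i \<le> ?d"
    have "cmod (coeff p i - \<mu> * coeff (poly_from_roots (lead_coeff p) zs) i) = cmod (coeff p i - coeff q i)"
      by (simp add: \<mu>)
    also have "\<dots> \<le> K * \<epsilon> * hull_value p i"
      by (rule close[OF i])
    also have "\<dots> \<le> K * \<epsilon> * minmax_weight p i"
      using weight(1)[OF i] \<open>0 \<le> K\<close> \<epsilon> by (intro mult_left_mono) auto
    finally show "cmod (coeff p i - \<mu> * coeff (poly_from_roots (lead_coeff p) zs) i) \<le> K * \<epsilon> * minmax_weight p i" .
  qed
qed

theorem theorem2:
  fixes d :: nat and C :: real
  assumes "d \<ge> 1"
  shows "\<exists>K>0. \<exists>\<epsilon>0>0. \<forall>(\<epsilon>::real) (p :: complex poly) (qz :: qz_alg) (zs :: complex list).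
           0 < \<epsilon> \<and> \<epsilon> \<le> \<epsilon>0 \<and> degree p = d \<and> coeff p 0 \<noteq> 0 \<and>
           qz_assumption C \<epsilon> qz p \<and> computes_roots qz p zs \<longrightarrow>
           elem_backward_error (minmax_weight p) p zs \<le> K * \<epsilon>"
proof -
  \<comment> \<open>The constant depends on \<open>d\<close> and \<open>C\<close> only; the summand
    1 keeps it positive when \<open>C = 0\<close>.\<close>
  define K where "K = fact (d + 1) * 2 ^ (d + 1) * 2 ^ d * \<bar>C\<bar> + 1"
  have "0 < K"
    unfolding K_def by (intro add_nonneg_pos) auto
  show ?thesis
  \<comment> \<open>The threshold \<open>1 / (2 * K)\<close> ensures
    \<open>K * \<epsilon> \<le> 1 / 2\<close>.\<close>
  proof (rule exI[of _ K], intro conjI, rule \<open>0 < K\<close>, rule exI[of _ "1 / (2 * K)"], intro conjI allI impI)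
    fix \<epsilon> :: real and p qz zs
    assume *: "0 < \<epsilon> \<and> \<epsilon> \<le> 1 / (2 * K) \<and> degree p = d \<and> coeff p 0 \<noteq> 0 \<and>
      qz_assumption C \<epsilon> qz p \<and> computes_roots qz p zs"
    then have "K * \<epsilon> \<le> K * (1 / (2 * K))"
      using \<open>0 < K\<close> by (intro mult_left_mono) auto
    then have "K * \<epsilon> < 1"
      using \<open>0 < K\<close> by simp
    then show "elem_backward_error (minmax_weight p) p zs \<le> K * \<epsilon>"
      using * assms by (intro backward_error_bound[of p C \<epsilon> qz zs K]) (auto simp: K_def)
  qed (use \<open>0 < K\<close> in auto)
qed

end
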